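(* Let $(\boldsymbol c^{p-1},X^{p-1})$ be such that $\boldsymbol c^{p-1}\ge0$ and $\sum_{i=1}^nc_{i,K}^{p-1}=1$ for any $K\in\{1,\dots,N\}$. Let $(\boldsymbol c^p,X^p)$ be a solution to the modified scheme $(\widetilde S)$. It holds $$\mathcal H^p(\boldsymbol c^p,X^p)+\frac{\Delta t}{\Delta x}\sum_{K\ne K^{p-1}}\big(D_{K+\frac12}\log(\boldsymbol c^{p,\star})\big)^T\,\widehat{\boldsymbol M}_{\alpha_K^{p-1}}(\boldsymbol c^{p,\star}_{K+\frac12})\,D_{K+\frac12}\log(\boldsymbol c^{p,\star})$$ $$+\Delta t\sum_{i=1}^nF_i^{p,\star}\,D_{K^{p-1}+\frac12}\big(\log(\boldsymbol c_i^{p,\star})+\mu_i^{*}\big)\le\mathcal H^{p-1}(\boldsymbol c^{p-1},X^{p-1}),$$ where the sum over $K$ runs over $K\in\{1,\dots,N-1\}$, $K\neq K^{p-1}$, and $D_{K^{p-1}+\frac12}(\log(\boldsymbol c_i^{p,\star})+\mu_i^* )=\big(\log c^{p,\star}_{i,K^{p-1}+1}+\mu_i^{*,g}\big)-\big(\log c^{p,\star}_{i,K^{p-1}}+\mu_i^{*,s}\big)$. In particular, $\mathcal H^p(\boldsymbol c^p,X^p)\le\mathcal H^{p-1}(\boldsymbol c^{p-1},X^{p-1})$.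
   Context: Parameters. There are $n$ species; $\mathcal A=\{\boldsymbol c\in\mathbb R_+^n:\sum_ic_i=1\}$. For $\alpha\in\{s,g\}$ (solid, gas) let $\kappa_{ij}^\alpha=\kappa_{ji}^\alpha>0$ for $i\neq j$, $\kappa^{*,\alpha}=\min_{i\ne j}\kappa^\alpha_{ij}>0$, $\bar\kappa^\alpha_{ij}=\kappa^\alpha_{ij}-\kappa^{*,\alpha}\ge0$ for $i\ne j$. For $\boldsymbol u\in\mathbb R^n$ let $\bar{\boldsymbol A}_\alpha(\boldsymbol u)\in\mathbb R^{n\times n}$ have entries $(\bar{\boldsymbol A}_\alpha)_{ii}(\boldsymbol u)=\sum_{j\ne i}\bar\kappa^\alpha_{ij}u_j$ and $(\bar{\boldsymbol A}_\alpha)_{ij}(\boldsymbol u)=-\bar\kappa^\alpha_{ij}u_i$ for $i\ne j$. With $\boldsymbol I$ the identity matrix, set $\widehat{\boldsymbol A}_s(\boldsymbol u)=\bar{\boldsymbol A}_s(\boldsymbol u)+\kappa^{*,s}\boldsymbol I$, $\check{\widetilde{\boldsymbol A}}_g(\boldsymbol u)=\bar{\boldsymbol A}_g(\boldsymbol u)+\kappa^{*,g}\boldsymbol I$ and, when the latter is invertible (which is the case at the edge values of solutions), $\widehat{\boldsymbol A}_g(\boldsymbol u)=\check{\widetilde{\boldsymbol A}}_g(\boldsymbol u)^{-1}$. The modified mobility matrices are $\widehat{\boldsymbol M}_\alpha(\boldsymbol u)=\widehat{\boldsymbol A}_\alpha(\boldsymbol u)\,\mathrm{diag}(u_1,\dots,u_n)$.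 Let $\boldsymbol\mu^{*,s},\boldsymbol\mu^{*,g}\in\mathbb R^n$ and $\beta_i^*=\exp(\mu_i^{*,g}-\mu_i^{*,s})$. Mesh. $N\in\mathbb N^*$, $\Delta x=1/N$, $x_{K+\frac12}=K\Delta x$ for $0\le K\le N$; $p\ge1$. For an interface position $X^{q}\in[0,1]$ ($q\in\{p-1,p\}$), $K^{q}\in\{0,\dots,N\}$ denotes the lowest integer minimizing $K\mapsto|x_{K+\frac12}-X^{q}|$. Cell sizes, for $1\le K\le N$: $\Delta^q_{K}=X^q-x_{K^q-\frac12}$ if $K=K^q$, $\Delta^q_{K}=x_{K^q+\frac32}-X^q$ if $K=K^q+1$, $\Delta^q_K=\Delta x$ otherwise. Standing assumption on the time step: $0<\Delta t<\Delta x/(2C)$ with $C=\max_i2\cosh\big(\tfrac12(\mu_i^{*,g}-\mu_i^{*,s})\big)$. Notation. For $\boldsymbol c=(c_{i,K})\in(\mathbb R^n)^N$, $\boldsymbol c_K=(c_{i,K})_i$, $\boldsymbol c_i=(c_{i,K})_K$, and $D_{K+\frac12}\boldsymbol d=\boldsymbol d_{K+1}-\boldsymbol d_K$; $\log$ is taken componentwise. Edge values $\boldsymbol c_{K+\frac12}=(c_{i,K+\frac12})_i$, $1\le K\le N-1$: $c_{i,K+\frac12}=0$ if $\min(c_{i,K},c_{i,K+1})\le0$; $c_{i,K+\frac12}=c_{i,K}$ if $0<c_{i,K}=c_{i,K+1}$; $c_{i,K+\frac12}=\frac{c_{i,K}-c_{i,K+1}}{\log c_{i,K}-\log c_{i,K+1}}$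 otherwise. A continuous map $\mathbb R^n\ni\boldsymbol x\mapsto\boldsymbol x^\diamond\in\mathbb R^n$ is fixed such that (P1) $0\le x_i^\diamond\le1$ for all $\boldsymbol x$ and $i$; (P2) $\boldsymbol x^\diamond=\boldsymbol x$ for $\boldsymbol x\in\mathcal A$; (P3) if $\sum_ix_i=1$ then, for each $i$, $x_i^\diamond=0$ if and only if $x_i\le0$; for example $x_i^\diamond=x_i^+/\max(1,\sum_jx_j^+)$ with $x^+=\max(x,0)$. $c^\diamond_{i,K}$ denotes the $i$-th component of $(\boldsymbol c_K)^\diamond$. Modified scheme $(\widetilde S)$ (one time step). Given $(\boldsymbol c^{p-1},X^{p-1})\in\mathcal A^N\times(0,1)$ with $1<K^{p-1}<N$, find $\boldsymbol c^{p,\star}\in(\mathbb R^n)^N$, a new interface location $\widetilde X^p\in[0,1]$ and fluxes $\boldsymbol J^{p,\star}_{K+\frac12}\in\mathbb R^n$ such that for all $i\in\{1,\dots,n\}$ and $1\le K\le N$ $$\tfrac1{\Delta t}\big(\Delta_K^{p,\star}c^{p,\star}_{i,K}-\Delta_K^{p-1}c^{p-1}_{i,K}\big)+J^{p,\star}_{i,K+\frac12}-J^{p,\star}_{i,K-\frac12}=0,\qquad(\mathrm{CL})$$ where $\Delta^{p,\star}_{K^{p-1}}=\widetilde X^p-x_{K^{p-1}-\frac12}$, $\Delta^{p,\star}_{K^{p-1}+1}=x_{K^{p-1}+\frac32}-\widetilde X^p$, $\Delta^{p,\star}_K=\Delta x$ otherwise; $\boldsymbol J^{p,\star}_{\frac12}=\boldsymbol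 J^{p,\star}_{N+\frac12}=0$; $\Delta x\,\boldsymbol J^{p,\star}_{K+\frac12}=-\widehat{\boldsymbol A}_s(\boldsymbol c^{p,\star}_{K+\frac12})D_{K+\frac12}\boldsymbol c^{p,\star}$ for $1\le K<K^{p-1}$; $\Delta x\,\check{\widetilde{\boldsymbol A}}_g(\boldsymbol c^{p,\star}_{K+\frac12})\boldsymbol J^{p,\star}_{K+\frac12}=-D_{K+\frac12}\boldsymbol c^{p,\star}$ for $K^{p-1}<K\le N-1$ (any solution of this linear system). With $\widetilde F_i^{p,\star}=\sqrt{\beta_i^*}\,(c^{p,\star}_{i,K^{p-1}+1})^\diamond-\frac1{\sqrt{\beta_i^*}}(c^{p,\star}_{i,K^{p-1}})^\diamond$, the flux at $K^{p-1}+\frac12$ is $-\big(\sum_jc^{p,\star}_{j,K^{p-1}}\big)\widetilde{\boldsymbol F}^{p,\star}$ in (CL) for the cell $K=K^{p-1}$ and $-\big(\sum_jc^{p,\star}_{j,K^{p-1}+1}\big)\widetilde{\boldsymbol F}^{p,\star}$ in (CL) for the cell $K=K^{p-1}+1$; and $\widetilde X^p=X^{p-1}+\Delta t\sum_i\widetilde F_i^{p,\star}$. Also $F^{p,\star}_i=\sqrt{\beta_i^*}\,c^{p,\star}_{i,K^{p-1}+1}-\frac1{\sqrt{\beta_i^*}}c^{p,\star}_{i,K^{p-1}}$. Post-processing, defining $(\boldsymbol c^p,X^p)$. Set $X^p=\widetilde X^p$ and compute $K^p$; by the time-step assumption $|K^p-K^{p-1}|\le1$. If $K^p=K^{p-1}$: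 $\boldsymbol c^p=\boldsymbol c^{p,\star}$. If $K^p=K^{p-1}+1<N$: $c^p_{i,K^{p-1}}=c^p_{i,K^{p-1}+1}=c^{p,\star}_{i,K^{p-1}}$, $c^p_{i,K^p+1}=\frac{\Delta^{p,\star}_{K^p}c^{p,\star}_{i,K^p}+\Delta x\,c^{p,\star}_{i,K^p+1}}{\Delta x+\Delta^{p,\star}_{K^p}}$, and $c^p_{i,K}=c^{p,\star}_{i,K}$ for the other $K$. If $K^p=K^{p-1}-1>1$, symmetrically: $c^p_{i,K^{p-1}}=c^p_{i,K^{p-1}+1}=c^{p,\star}_{i,K^{p-1}+1}$, $c^p_{i,K^{p-1}-1}=\frac{\Delta x\,c^{p,\star}_{i,K^{p-1}-1}+\Delta^{p,\star}_{K^{p-1}}c^{p,\star}_{i,K^{p-1}}}{\Delta x+\Delta^{p,\star}_{K^{p-1}}}$, and $c^p_{i,K}=c^{p,\star}_{i,K}$ for the other $K$. In the limit cases $K^p=N$ (resp. $K^p=1$), one considers that only a single phase remains in the system and definitively sets $X^p=1$ (resp. $X^p=0$); no further prescription for $\boldsymbol c^p$ is made in these cases. A solution $(\boldsymbol c^p,X^p)$ to $(\widetilde S)$ is the outcome of this procedure. Discrete free energy. For $\alpha\in\{s,g\}$, $h_\alpha(\boldsymbol c)=\sum_{i=1}^n\big(c_i(\log c_i+\mu_i^{*,\alpha})-c_i+1\big)$ (with $0\log0=0$); $\alpha_K^q=s$ if $K\le K^q$ and $\alpha_K^q=g$ if $K>K^q$; $\mathcal H^q(\boldsymbol c^q,X^q)=\sum_{K=1}^N\Delta_K^qh_{\alpha_K^q}(\boldsymbol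 c_K^q)$.
   Formalization: The map x ↦ x^⋄ is also assumed to satisfy Σ_i x_i^⋄ ≤ 1 whenever Σ_i x_i = 1 (true for the example map); with (P1)–(P3) alone the energy can increase. The limit cases K^p = 1 and K^p = N, where c^p is not prescribed, are excluded. *)

theory Defs
  imports "HOL-Analysis.Analysis"
begin

text \<open>
  Cell \<open>K\<close> is \<open>[x (K - 1/2), x (K + 1/2)]\<close> for \<open>1 \<le> K \<le> N\<close>.  A quantity attached to the edge
  \<open>K + 1/2\<close> is indexed by the natural number \<open>K\<close>; cell quantities outside \<open>{1..N}\<close> and edge
  quantities outside \<open>{0..N}\<close> are never used.  Species are indexed by the finite type \<open>'n\<close>.
\<close>

datatype phase = Solid | Gas

definition composition_simplex :: "(real ^ 'n) set" where
  "composition_simplex = {c. (\<forall>i. 0 \<le> c $ i) \<and> (\<Sum>i\<in>UNIV. c $ i) = 1}"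

definition kappa_min :: "('n::finite \<Rightarrow> 'n \<Rightarrow> real) \<Rightarrow> real" where
  "kappa_min k = Min {k i j | i j. i \<noteq> j}"

definition kappa_bar :: "('n::finite \<Rightarrow> 'n \<Rightarrow> real) \<Rightarrow> 'n \<Rightarrow> 'n \<Rightarrow> real" where
  "kappa_bar k i j = k i j - kappa_min k"

definition A_bar :: "('n::finite \<Rightarrow> 'n \<Rightarrow> real) \<Rightarrow> real ^ 'n \<Rightarrow> real ^ 'n ^ 'n" where
  "A_bar k u = (\<chi> i j. if i = j then \<Sum>l\<in>UNIV - {i}. kappa_bar k i l * u $ l
                        else - kappa_bar k i j * u $ i)"

text \<open>The shifted matrix is used as it is in the solid, and through its inverse in the gas.\<close>

definition A_shift :: "('n::finite \<Rightarrow> 'n \<Rightarrow> real) \<Rightarrow> real ^ 'n \<Rightarrow> real ^ 'n ^ 'n" where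
  "A_shift k u = A_bar k u + kappa_min k *\<^sub>R mat 1"

fun A_hat :: "(phase \<Rightarrow> 'n::finite \<Rightarrow> 'n \<Rightarrow> real) \<Rightarrow> phase \<Rightarrow> real ^ 'n \<Rightarrow> real ^ 'n ^ 'n" where
  "A_hat kappa Solid u = A_shift (kappa Solid) u"
| "A_hat kappa Gas u = matrix_inv (A_shift (kappa Gas) u)"

definition diag_mat :: "real ^ 'n \<Rightarrow> real ^ 'n ^ 'n" where
  "diag_mat u = (\<chi> i j. if i = j then u $ i else 0)"

definition M_hat :: "(phase \<Rightarrow> 'n::finite \<Rightarrow> 'n \<Rightarrow> real) \<Rightarrow> phase \<Rightarrow> real ^ 'n \<Rightarrow> real ^ 'n ^ 'n" where
  "M_hat kappa \<alpha> u = A_hat kappa \<alpha> u ** diag_mat u"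

definition edge_pos :: "nat \<Rightarrow> nat \<Rightarrow> real" where
  "edge_pos N K = real K * (1 / real N)"

definition interface_index :: "nat \<Rightarrow> real \<Rightarrow> nat" where
  "interface_index N X =
     (LEAST K. K \<le> N \<and> (\<forall>L\<le>N. \<bar>edge_pos N K - X\<bar> \<le> \<bar>edge_pos N L - X\<bar>))"

text \<open>
  Size of cell \<open>K\<close> when the edge \<open>L + 1/2\<close> is moved to the position \<open>X\<close>.  With
  \<open>L = interface_index N X\<close> this is the size in the mesh adapted to \<open>X\<close>; with \<open>L\<close> the index
  of the previous interface position it is the intermediate (starred) size.
\<close>

definition moved_size :: "nat \<Rightarrow> nat \<Rightarrow> real \<Rightarrow> nat \<Rightarrow> real" where
  "moved_size N L X K =
     (if K = L then X - edge_pos N (K - 1)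
      else if K = L + 1 then edge_pos N K - X
      else 1 / real N)"

definition cell_size :: "nat \<Rightarrow> real \<Rightarrow> nat \<Rightarrow> real" where
  "cell_size N X K = moved_size N (interface_index N X) X K"

definition phase_of_cell :: "nat \<Rightarrow> real \<Rightarrow> nat \<Rightarrow> phase" where
  "phase_of_cell N X K = (if K \<le> interface_index N X then Solid else Gas)"

definition D_edge :: "(nat \<Rightarrow> real ^ 'n) \<Rightarrow> nat \<Rightarrow> real ^ 'n" where
  "D_edge d K = d (K + 1) - d K"

text \<open>
  Since \<open>ln 0 = 0\<close> in HOL, \<open>x * ln x\<close> follows the convention \<open>0 log 0 = 0\<close>.  Differences of
  logarithms are unaffected by this choice: in a solution of the scheme a species is either
  positive in all cells or absent from all of them, and then its edge values and exchange rate,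
  which multiply these differences, vanish.
\<close>

definition vec_log :: "real ^ 'n \<Rightarrow> real ^ 'n" where
  "vec_log c = (\<chi> i. ln (c $ i))"

definition log_mean :: "real \<Rightarrow> real \<Rightarrow> real" where
  "log_mean a b = (if min a b \<le> 0 then 0 else if a = b then a else (a - b) / (ln a - ln b))"

definition edge_value :: "(nat \<Rightarrow> real ^ 'n) \<Rightarrow> nat \<Rightarrow> real ^ 'n" where
  "edge_value c K = (\<chi> i. log_mean (c K $ i) (c (K + 1) $ i))"

text \<open>
  These properties do not bound the sum of the components of \<open>T x\<close>.  That the interface moves by
  less than half a cell when the time step is smaller than \<open>dx / (2 * time_step_const mu)\<close> needs in
  addition that this sum is at most 1 whenever the components of \<open>x\<close> sum to 1; otherwise an
  intermediate cell size can be negative and the free energy can increase.  The standard choice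
  \<open>T x $ i = max (x $ i) 0 / max 1 (\<Sum>j. max (x $ j) 0)\<close> has both properties.
\<close>

definition truncation_map :: "(real ^ 'n \<Rightarrow> real ^ 'n) \<Rightarrow> bool" where
  "truncation_map T \<longleftrightarrow>
     continuous_on UNIV T \<and>
     (\<forall>x i. 0 \<le> T x $ i \<and> T x $ i \<le> 1) \<and>
     (\<forall>x\<in>composition_simplex. T x = x) \<and>
     (\<forall>x. (\<Sum>i\<in>UNIV. x $ i) = 1 \<longrightarrow> (\<forall>i. T x $ i = 0 \<longleftrightarrow> x $ i \<le> 0))"

definition beta :: "(phase \<Rightarrow> real ^ 'n) \<Rightarrow> 'n \<Rightarrow> real" where
  "beta mu i = exp (mu Gas $ i - mu Solid $ i)"

text \<open>Exchange rate at the interface, from the solid-side and gas-side concentrations.\<close>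

definition interface_rate ::
  "(phase \<Rightarrow> real ^ 'n) \<Rightarrow> real ^ 'n \<Rightarrow> real ^ 'n \<Rightarrow> real ^ 'n" where
  "interface_rate mu cs cg = (\<chi> i. sqrt (beta mu i) * cg $ i - 1 / sqrt (beta mu i) * cs $ i)"

definition time_step_const :: "(phase \<Rightarrow> real ^ 'n::finite) \<Rightarrow> real" where
  "time_step_const mu = Max (range (\<lambda>i. 2 * cosh (1 / 2 * (mu Gas $ i - mu Solid $ i))))"

text \<open>
  \<open>modified_scheme kappa mu T N dt c0 X0 cs Xt J\<close>: the intermediate concentrations \<open>cs\<close>, the
  interface location \<open>Xt\<close> and the fluxes \<open>J\<close> solve the modified scheme for the data \<open>(c0, X0)\<close>.
  The flux at the interface edge \<open>L + 1/2\<close> takes different values seen from the cells \<open>L\<close> and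
  \<open>L + 1\<close>; it is given explicitly in terms of \<open>cs\<close>, and \<open>J L\<close> is not used.
\<close>

definition modified_scheme ::
  "(phase \<Rightarrow> 'n::finite \<Rightarrow> 'n \<Rightarrow> real) \<Rightarrow> (phase \<Rightarrow> real ^ 'n) \<Rightarrow> (real ^ 'n \<Rightarrow> real ^ 'n) \<Rightarrow>
   nat \<Rightarrow> real \<Rightarrow> (nat \<Rightarrow> real ^ 'n) \<Rightarrow> real \<Rightarrow>
   (nat \<Rightarrow> real ^ 'n) \<Rightarrow> real \<Rightarrow> (nat \<Rightarrow> real ^ 'n) \<Rightarrow> bool" where
  "modified_scheme kappa mu T N dt c0 X0 cs Xt J \<longleftrightarrow>
     (let L = interface_index N X0;
          F = interface_rate mu (T (cs L)) (T (cs (L + 1)));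
          interface_flux = (\<lambda>K. - (\<Sum>j\<in>UNIV. cs K $ j) *\<^sub>R F);
          flux_right = (\<lambda>K. if K = L then interface_flux K else J K);
          flux_left = (\<lambda>K. if K = L + 1 then interface_flux K else J (K - 1))
      in
        0 \<le> Xt \<and> Xt \<le> 1 \<and>
        Xt = X0 + dt * (\<Sum>i\<in>UNIV. F $ i) \<and>
        J 0 = 0 \<and> J N = 0 \<and>
        (\<forall>K\<in>{1..N}. \<forall>i.
           1 / dt * (moved_size N L Xt K * cs K $ i - cell_size N X0 K * c0 K $ i)
             + flux_right K $ i - flux_left K $ i = 0) \<and>
        (\<forall>K. 1 \<le> K \<and> K < L \<longrightarrow>
           (1 / real N) *\<^sub>R J K = - (A_hat kappa Solid (edge_value cs K) *v D_edge cs K)) \<and>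
        (\<forall>K. L < K \<and> K \<le> N - 1 \<longrightarrow>
           (1 / real N) *\<^sub>R (A_shift (kappa Gas) (edge_value cs K) *v J K) = - D_edge cs K))"

text \<open>
  \<open>post_processing N X0 cs Xt c1 X1\<close>: the outcome \<open>(c1, X1)\<close> of the projection onto the mesh
  adapted to the new interface.  In the limit cases, where the new index is \<open>1\<close> or \<open>N\<close>, only
  \<open>X1\<close> is prescribed.
\<close>

definition post_processing ::
  "nat \<Rightarrow> real \<Rightarrow> (nat \<Rightarrow> real ^ 'n) \<Rightarrow> real \<Rightarrow> (nat \<Rightarrow> real ^ 'n) \<Rightarrow> real \<Rightarrow> bool" where
  "post_processing N X0 cs Xt c1 X1 \<longleftrightarrow>
     (let L = interface_index N X0;
          L' = interface_index N Xt;
          dx = 1 / real N;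
          d = moved_size N L Xt
      in
        X1 = (if L' = N then 1 else if L' = 1 then 0 else Xt) \<and>
        (L' = L \<longrightarrow> (\<forall>K\<in>{1..N}. c1 K = cs K)) \<and>
        (L' = L + 1 \<and> L' < N \<longrightarrow>
           (\<forall>K\<in>{1..N}. c1 K =
              (if K = L \<or> K = L + 1 then cs L
               else if K = L' + 1
                 then (1 / (dx + d L')) *\<^sub>R (d L' *\<^sub>R cs L' + dx *\<^sub>R cs (L' + 1))
               else cs K))) \<and>
        (L' + 1 = L \<and> 1 < L' \<longrightarrow>
           (\<forall>K\<in>{1..N}. c1 K =
              (if K = L \<or> K = L + 1 then cs (L + 1)
               else if K = L - 1
                 then (1 / (dx + d L)) *\<^sub>R (dx *\<^sub>R cs (L - 1) + d L *\<^sub>R cs L)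
               else cs K))))"

definition energy_density :: "(phase \<Rightarrow> real ^ 'n::finite) \<Rightarrow> phase \<Rightarrow> real ^ 'n \<Rightarrow> real" where
  "energy_density mu \<alpha> c = (\<Sum>i\<in>UNIV. c $ i * (ln (c $ i) + mu \<alpha> $ i) - c $ i + 1)"

definition free_energy ::
  "(phase \<Rightarrow> real ^ 'n::finite) \<Rightarrow> nat \<Rightarrow> (nat \<Rightarrow> real ^ 'n) \<Rightarrow> real \<Rightarrow> real" where
  "free_energy mu N c X =
     (\<Sum>K=1..N. cell_size N X K * energy_density mu (phase_of_cell N X K) (c K))"

end

theory Submission
  imports Defs
begin

text \<open>
  The free energy is a sum of convex functions of the concentrations, and the logarithmic edge
  value is chosen so that \<open>D c = diag (edge value) (D log c)\<close>.  Testing the conservation law with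
  the chemical potential \<open>p = log c + mu\<close>, which is the derivative of the energy density, therefore
  turns the fluxes into the quadratic forms of the mobility matrices.

  More precisely, \<open>h c - p \<bullet> c\<close> is a constant on compositions of total mass one, so convexity gives,
  cell by cell,
  \<open>d h(c) - d0 h(c0) \<le> (d - d0) * const + p \<bullet> (d c - d0 c0)\<close>
  with old sizes \<open>d0\<close> and intermediate sizes \<open>d\<close>.  Since the interface only transfers length from
  one cell to its neighbour, the first terms sum to zero; by conservation and summation by parts
  the second ones give minus the dissipation minus the exchange term
  (\<open>intermediate_energy_le\<close>).  Post-processing splits one cell at constant composition and merges
  two cells of the same phase, so Jensen's inequality shows that it does not increase the energy
  (\<open>post_processing_energy_le\<close>).  Both dissipative terms are nonnegative: the mobilities are
  positive semidefinite, and the exchange rate has the sign of the jump of chemical potential.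

  This computation needs a priori facts about the solution, which come in a forced order.
  The columns of the cross-diffusion matrices have a constant sum, so the total mass solves a
  scalar discrete heat equation and equals one (\<open>mass_one\<close>).  Then the truncated exchange rates
  are bounded, the interface moves by less than half a cell, and all intermediate sizes are
  positive (\<open>d_pos\<close>).  Testing with negative parts gives \<open>cs_nonneg\<close>, which makes the truncation
  inactive (\<open>rate_eq\<close>).  A discrete strong maximum principle shows that each species is positive
  in every cell or absent from the whole domain (\<open>species_absent\<close>); this legitimates the
  logarithms, because an absent species contributes nothing whatever value \<open>ln 0\<close> has.
\<close>

section \<open>Sequences with balanced fluxes\<close>

lemma summation_by_parts:
  fixes g G :: "nat \<Rightarrow> real"
  assumes "G 0 = 0" "G N = 0"
  shows "(\<Sum>K=1..N. g K * (G K - G (K - 1))) = - (\<Sum>K=1..N-1. G K * (g (K + 1) - g K))"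
proof -
  have "(\<Sum>K=1..M. g K * (G K - G (K - 1)))
          = g M * G M - (\<Sum>K=1..M-1. G K * (g (K + 1) - g K))" if "1 \<le> M" for M
    using that
  proof (induction M rule: nat_induct_at_least)
    case base
    then show ?case by (simp add: assms)
  next
    case (Suc n)
    then obtain m where "n = Suc m" by (cases n) auto
    with Suc show ?case by (simp add: algebra_simps)
  qed
  from this[of N] show ?thesis
    by (cases "1 \<le> N") (auto simp: assms)
qed

text \<open>
  The energy method: the storage terms \<open>g K * a K\<close> are nonnegative, and by parts their sum equals
  the nonpositive work of the fluxes.  It serves for the uniqueness of the total mass
  (\<open>a = d0 * g\<close>) and for nonnegativity (with the negative part as \<open>g\<close>).
\<close>

lemma balanced_test_zero:
  fixes a g G :: "nat \<Rightarrow> real"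
  assumes G: "G 0 = 0" "G N = 0"
    and balance: "\<And>K. K \<in> {1..N} \<Longrightarrow> a K + G K - G (K - 1) = 0"
    and test: "\<And>K. K \<in> {1..N} \<Longrightarrow> 0 \<le> g K * a K"
    and dissipative: "\<And>K. K \<in> {1..N-1} \<Longrightarrow> G K * (g (K + 1) - g K) \<le> 0"
    and K: "K \<in> {1..N}"
  shows "g K * a K = 0"
proof -
  have "(\<Sum>K=1..N. g K * a K) = - (\<Sum>K=1..N. g K * (G K - G (K - 1)))"
    unfolding sum_negf[symmetric]
  proof (rule sum.cong)
    fix K assume "K \<in> {1..N}"
    then have "a K = - (G K - G (K - 1))" using balance by fastforce
    then show "g K * a K = - (g K * (G K - G (K - 1)))"
      by (simp only: mult_minus_right)
  qed simp
  also have "\<dots> = (\<Sum>K=1..N-1. G K * (g (K + 1) - g K))"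
    using summation_by_parts[OF G] by simp
  also have "\<dots> \<le> 0"
    using dissipative by (intro sum_nonpos) auto
  finally have "(\<Sum>K=1..N. g K * a K) = 0"
    using test by (meson antisym sum_nonneg)
  then have "\<forall>K\<in>{1..N}. g K * a K = 0"
    using sum_nonneg_eq_0_iff[of "{1..N}" "\<lambda>K. g K * a K"] test by blast
  with K show ?thesis by blast
qed

text \<open>
  A discrete strong maximum principle.  Nothing can flow out of an empty cell, so its balance
  forces all its inflows, and its previous content, to vanish; a vanishing inflow empties the
  neighbour, and emptiness spreads in both directions.
\<close>

lemma zero_spreads:
  fixes c b d G :: "nat \<Rightarrow> real"
  assumes G: "G 0 = 0" "G N = 0"
    and balance: "\<And>K. K \<in> {1..N} \<Longrightarrow> d K * c K - b K + G K - G (K - 1) = 0"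
    and b: "\<And>K. K \<in> {1..N} \<Longrightarrow> 0 \<le> b K"
    and right: "\<And>K. K \<in> {1..N-1} \<Longrightarrow> c K = 0 \<Longrightarrow> G K \<le> 0 \<and> (G K = 0 \<longrightarrow> c (K + 1) = 0)"
    and left: "\<And>K. K \<in> {1..N-1} \<Longrightarrow> c (K + 1) = 0 \<Longrightarrow> 0 \<le> G K \<and> (G K = 0 \<longrightarrow> c K = 0)"
    and M: "M \<in> {1..N}" "c M = 0"
    and K: "K \<in> {1..N}"
  shows "c K = 0 \<and> b K = 0"
proof -
  have step: "b K = 0 \<and> G K = 0 \<and> G (K - 1) = 0" if K: "K \<in> {1..N}" "c K = 0" for K
  proof -
    have "G K \<le> 0"
      using right[of K] G K by (cases "K = N") auto
    moreover have "0 \<le> G (K - 1)"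
    proof (cases "K = 1")
      case False
      with K have "K - 1 \<in> {1..N-1}" "K - 1 + 1 = K" by auto
      with left[of "K - 1"] K show ?thesis by simp
    qed (simp add: G)
    ultimately show ?thesis
      using balance[OF K(1)] b[OF K(1)] K(2) by auto
  qed
  have up: "c (Suc K) = 0" if "K \<in> {1..N-1}" "c K = 0" for K
  proof -
    from that have "K \<in> {1..N}" by auto
    with right[OF that] step[of K] that show ?thesis by simp
  qed
  have down: "c K = 0" if "K \<in> {1..N-1}" "c (Suc K) = 0" for K
  proof -
    from that have "Suc K \<in> {1..N}" by auto
    with left[of K] step[of "Suc K"] that show ?thesis by simp
  qed
  have "c K = 0"
  proof (cases "M \<le> K")
    case True
    then have "K \<le> N \<longrightarrow> c K = 0"
      by (induction K rule: dec_induct) (use M up in auto)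
    with K show ?thesis by simp
  next
    case False
    then have "K \<le> M" by simp
    then have "1 \<le> K \<longrightarrow> c K = 0"
      by (induction K rule: inc_induct) (use M down in auto)
    with K show ?thesis by simp
  qed
  with step K show ?thesis by simp
qed

section \<open>The nearest edge and the cell sizes\<close>

lemma interface_index_nearest:
  "interface_index N X \<le> N
    \<and> (\<forall>M\<le>N. \<bar>edge_pos N (interface_index N X) - X\<bar> \<le> \<bar>edge_pos N M - X\<bar>)"
proof -
  let ?f = "\<lambda>K. \<bar>edge_pos N K - X\<bar>"
  obtain K where "K \<in> {..N}" "\<forall>M\<in>{..N}. ?f K \<le> ?f M"
    using ex_is_arg_min_if_finite[of "{..N}" ?f] by (auto simp: is_arg_min_linorder)
  then have "\<exists>K. K \<le> N \<and> (\<forall>M\<le>N. ?f K \<le> ?f M)" by auto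
  then show ?thesis
    unfolding interface_index_def by (rule LeastI_ex)
qed

text \<open>
  Any point of the unit interval is within half a cell of the grid point obtained by rounding, and
  the interface index does at least as well.
\<close>

lemma interface_index_close:
  assumes "1 \<le> N" "0 \<le> X" "X \<le> 1"
  shows "2 * \<bar>edge_pos N (interface_index N X) - X\<bar> \<le> 1 / real N"
proof -
  define r where "r = round (X * real N)"
  have r: "\<bar>of_int r - X * real N\<bar> \<le> 1 / 2"
    unfolding r_def by (rule of_int_round_abs_le)
  have "0 \<le> X * real N" "X * real N \<le> real N"
    using assms by (auto simp: mult_left_le_one_le)
  with r have "0 \<le> r" "r \<le> int N" by linarith+
  then obtain M where M: "r = int M" "M \<le> N"
    by (metis nonneg_int_cases of_nat_le_iff)
  have "edge_pos N M - X = (of_int r - X * real N) / real N"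
    using assms(1) by (simp add: edge_pos_def M(1) field_simps)
  then have "\<bar>edge_pos N M - X\<bar> \<le> 1 / 2 / real N"
    using divide_right_mono[OF r, of "real N"] by simp
  moreover have "\<bar>edge_pos N (interface_index N X) - X\<bar> \<le> \<bar>edge_pos N M - X\<bar>"
    using interface_index_nearest[of N X] M(2) by blast
  ultimately show ?thesis by simp
qed

lemma edge_pos_pred: "1 \<le> K \<Longrightarrow> edge_pos N (K - Suc 0) = edge_pos N K - 1 / real N"
  by (simp add: edge_pos_def of_nat_diff diff_divide_distrib)

lemma edge_pos_Suc: "edge_pos N (Suc K) = edge_pos N K + 1 / real N"
  by (simp add: edge_pos_def add_divide_distrib)

lemma moved_size_diff:
  "moved_size N L Y K - moved_size N L X K
    = (if K = L then Y - X else 0) - (if K = L + 1 then Y - X else 0)"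
  by (simp add: moved_size_def)

lemma sum_moved_size:
  assumes "1 \<le> L" "L < N"
  shows "(\<Sum>K=1..N. moved_size N L Y K) = (\<Sum>K=1..N. moved_size N L X K)"
proof -
  have "(\<Sum>K=1..N. moved_size N L Y K - moved_size N L X K) = 0"
    unfolding moved_size_diff sum_subtractf using assms by simp
  then show ?thesis by (simp add: sum_subtractf)
qed

lemma moved_size_pos:
  assumes "1 \<le> L" "0 < real N" "\<bar>X - edge_pos N L\<bar> < 1 / real N"
  shows "0 < moved_size N L X K"
  using assms edge_pos_pred[of L N] edge_pos_Suc[of N L]
  by (auto simp: moved_size_def abs_less_iff)

section \<open>The mobility matrices\<close>

lemma kappa_min_attained:
  fixes k :: "'n::finite \<Rightarrow> 'n \<Rightarrow> real"
  assumes "2 \<le> CARD('n)"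
  obtains i j where "i \<noteq> j" "kappa_min k = k i j"
proof -
  let ?S = "{k i j | i j. i \<noteq> j}"
  have "finite ?S"
    by (rule finite_subset[of _ "range (\<lambda>(i, j). k i j)"]) auto
  moreover obtain i j :: 'n where "i \<noteq> j"
    using assms card_2_iff' card_le_Suc0_iff_eq[of "UNIV :: 'n set"] by fastforce
  then have "?S \<noteq> {}" by blast
  ultimately have "kappa_min k \<in> ?S"
    unfolding kappa_min_def by (rule Min_in)
  with that show ?thesis by blast
qed

lemma kappa_bar_nonneg:
  fixes k :: "'n::finite \<Rightarrow> 'n \<Rightarrow> real"
  assumes "i \<noteq> j"
  shows "0 \<le> kappa_bar k i j"
proof -
  have "finite {k i j | i j. i \<noteq> j}"
    by (rule finite_subset[of _ "range (\<lambda>(i, j). k i j)"]) auto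
  then have "kappa_min k \<le> k i j"
    unfolding kappa_min_def by (rule Min_le) (use assms in blast)
  then show ?thesis by (simp add: kappa_bar_def)
qed

text \<open>
  Writing the product through the antisymmetric quantities \<open>u l * x i - u i * x l\<close> removes the
  distinction between diagonal and off-diagonal entries: the term \<open>l = i\<close> vanishes, and the
  symmetry of the coefficients can be used directly on double sums.
\<close>

lemma A_shift_mult:
  fixes u x :: "real ^ 'n::finite"
  shows "(A_shift k u *v x) $ i
    = kappa_min k * x $ i + (\<Sum>l\<in>UNIV. kappa_bar k i l * (u $ l * x $ i - u $ i * x $ l))"
proof -
  have "(A_bar k u *v x) $ i = (\<Sum>l\<in>UNIV. A_bar k u $ i $ l * x $ l)"
    by (simp add: matrix_vector_mult_def)
  also have "\<dots> = A_bar k u $ i $ i * x $ i + (\<Sum>l\<in>UNIV - {i}. A_bar k u $ i $ l * x $ l)"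
    by (simp add: sum.remove)
  also have "\<dots> = (\<Sum>l\<in>UNIV - {i}. kappa_bar k i l * (u $ l * x $ i - u $ i * x $ l))"
    by (simp add: A_bar_def sum_distrib_right sum_subtractf sum_negf right_diff_distrib mult_ac
        sum_distrib_left)
  also have "\<dots> = (\<Sum>l\<in>UNIV. kappa_bar k i l * (u $ l * x $ i - u $ i * x $ l))"
    by (simp add: sum.remove[of UNIV i])
  finally show ?thesis
    by (simp add: A_shift_def matrix_vector_mult_add_rdistrib scaleR_matrix_vector_assoc[symmetric])
qed

lemma diag_mat_mult: "(diag_mat u *v x) $ i = u $ i * x $ i"
  by (simp add: diag_mat_def matrix_vector_mult_def if_distrib[of "\<lambda>y. y * _"] cong: if_cong)

context
  fixes k :: "'n::finite \<Rightarrow> 'n \<Rightarrow> real"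
  assumes species: "2 \<le> CARD('n)"
    and sym: "\<And>i j. i \<noteq> j \<Longrightarrow> k i j = k j i"
    and pos: "\<And>i j. i \<noteq> j \<Longrightarrow> 0 < k i j"
begin

lemma kappa_min_pos: "0 < kappa_min k"
  using kappa_min_attained[OF species, of k] pos by metis

lemma kappa_bar_sym: "kappa_bar k i j = kappa_bar k j i"
  using sym[of i j] by (cases "i = j") (auto simp: kappa_bar_def)

text \<open>
  Each column of the unshifted matrix sums to zero, by symmetry of the coefficients.  This is what
  decouples the total mass from the individual species.
\<close>

lemma sum_A_shift:
  "(\<Sum>i\<in>UNIV. (A_shift k u *v x) $ i) = kappa_min k * (\<Sum>i\<in>UNIV. x $ i)"
proof -
  have "(\<Sum>i\<in>UNIV. \<Sum>l\<in>UNIV. kappa_bar k i l * (u $ l * x $ i))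
      = (\<Sum>i\<in>UNIV. \<Sum>l\<in>UNIV. kappa_bar k i l * (u $ i * x $ l))"
    by (subst sum.swap) (simp add: kappa_bar_sym)
  then show ?thesis
    by (simp add: A_shift_mult sum.distrib sum_distrib_left right_diff_distrib sum_subtractf)
qed

text \<open>
  Where species \<open>i\<close> has zero edge value, row \<open>i\<close> keeps only its diagonal entry, which is positive:
  the flux of that species obeys a scalar diffusion law there.
\<close>

lemma A_shift_at_zero:
  assumes u: "\<And>j. 0 \<le> u $ j" and zero: "u $ i = 0"
  obtains a where "0 < a" "\<And>x. (A_shift k u *v x) $ i = a * x $ i"
proof
  let ?a = "kappa_min k + (\<Sum>l\<in>UNIV. kappa_bar k i l * u $ l)"
  have "0 \<le> kappa_bar k i l * u $ l" for l
    using u zero kappa_bar_nonneg[of i l k] by (cases "l = i") auto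
  then show "0 < ?a"
    using kappa_min_pos by (simp add: add_pos_nonneg sum_nonneg)
  show "(A_shift k u *v x) $ i = ?a * x $ i" for x
    by (simp add: A_shift_mult zero distrib_right sum_distrib_right mult.assoc)
qed

text \<open>
  Symmetrizing the double sum in \<open>i\<close> and \<open>l\<close> exhibits the form as a sum of squares, with terms
  \<open>(w i)^2\<close> from the shift and \<open>(w i - w l)^2\<close> from cross-diffusion.
\<close>

lemma A_shift_quadratic_form_nonneg:
  assumes u: "\<And>j. 0 \<le> u $ j"
  shows "0 \<le> w \<bullet> (A_shift k u *v (diag_mat u *v w))"
proof -
  let ?t = "\<lambda>i l. kappa_bar k i l * u $ i * u $ l"
  let ?S = "\<Sum>i\<in>UNIV. \<Sum>l\<in>UNIV. ?t i l * (w $ i * (w $ i - w $ l))"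
  have swapped: "?S = (\<Sum>i\<in>UNIV. \<Sum>l\<in>UNIV. ?t i l * (w $ l * (w $ l - w $ i)))"
    by (subst sum.swap) (simp add: kappa_bar_sym mult_ac)
  have "2 * ?S = (\<Sum>i\<in>UNIV. \<Sum>l\<in>UNIV. ?t i l * (w $ i - w $ l)^2)"
    unfolding mult_2
    by (subst (2) swapped) (simp add: sum.distrib[symmetric] power2_eq_square algebra_simps)
  moreover have "0 \<le> ?t i l * (w $ i - w $ l)^2" for i l
    using u kappa_bar_nonneg[of i l k] by (cases "i = l") auto
  ultimately have S: "0 \<le> ?S"
    by (metis (no_types, lifting) sum_nonneg zero_le_mult_iff zero_less_numeral not_less)
  have "w \<bullet> (A_shift k u *v (diag_mat u *v w))
      = kappa_min k * (\<Sum>i\<in>UNIV. u $ i * (w $ i)^2) + ?S"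
    by (simp add: inner_vec_def A_shift_mult diag_mat_mult sum.distrib distrib_left
        sum_distrib_left power2_eq_square algebra_simps sum_subtractf)
  then show ?thesis
    using S u kappa_min_pos by (simp add: sum_nonneg)
qed

text \<open>
  The matrix is strictly diagonally dominant by columns.  For the transpose this is a maximum
  principle: at a maximal component of a kernel vector, the row equation forces that component to
  be nonpositive, and the same applies to the opposite vector.
\<close>

lemma invertible_A_shift:
  assumes u: "\<And>j. 0 \<le> u $ j"
  shows "invertible (A_shift k u)"
proof -
  let ?B = "transpose (A_shift k u)"
  have B_mult: "(?B *v y) $ j
      = kappa_min k * y $ j + (\<Sum>l\<in>UNIV. kappa_bar k j l * u $ l * (y $ j - y $ l))" for y j
  proof -
    have "(?B *v y) $ j = y \<bullet> (A_shift k u *v axis j 1)"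
      unfolding matrix_vector_mult_basis
      by (simp add: inner_vec_def column_def matrix_vector_mult_def transpose_def mult.commute)
    also have "\<dots> = (\<Sum>i\<in>UNIV. y $ i * (kappa_min k * axis j 1 $ i))
        + (\<Sum>i\<in>UNIV. \<Sum>l\<in>UNIV. y $ i * (kappa_bar k i l * (u $ l * axis j 1 $ i)))
        - (\<Sum>i\<in>UNIV. \<Sum>l\<in>UNIV. y $ i * (kappa_bar k i l * (u $ i * axis j 1 $ l)))"
      by (simp add: inner_vec_def A_shift_mult distrib_left sum.distrib right_diff_distrib
          sum_subtractf sum_distrib_left)
    also have "\<dots> = kappa_min k * y $ j + (\<Sum>l\<in>UNIV. y $ j * (kappa_bar k j l * u $ l))
        - (\<Sum>i\<in>UNIV. y $ i * (kappa_bar k i j * u $ i))"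
      by (subst sum.swap)
         (simp add: axis_def if_distrib[of "\<lambda>t. _ * t"] sum.delta cong: if_cong)
    also have "\<dots> = kappa_min k * y $ j + (\<Sum>l\<in>UNIV. kappa_bar k j l * u $ l * (y $ j - y $ l))"
      by (simp add: kappa_bar_sym[of _ j] right_diff_distrib sum_subtractf mult_ac)
    finally show ?thesis .
  qed
  have nonpos: "y $ i \<le> 0" if y: "?B *v y = 0" for y i
  proof -
    obtain j where j: "\<And>l. y $ l \<le> y $ j"
      using finite_imageI[of UNIV "($) y"]
      by (metis (mono_tags, lifting) Max_ge Max_in UNIV_I empty_is_image finite imageE imageI UNIV_not_empty)
    have "0 \<le> kappa_bar k j l * u $ l * (y $ j - y $ l)" for l
      using u j kappa_bar_nonneg[of j l k] by (cases "j = l") auto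
    then have "0 \<le> (\<Sum>l\<in>UNIV. kappa_bar k j l * u $ l * (y $ j - y $ l))"
      by (intro sum_nonneg)
    then have "kappa_min k * y $ j \<le> 0"
      using B_mult[of y j] unfolding y zero_index by linarith
    then have "y $ j \<le> 0"
      using kappa_min_pos by (simp add: mult_le_0_iff)
    with j show ?thesis by (meson order_trans)
  qed
  have "y = 0" if y: "?B *v y = 0" for y
  proof -
    have "?B *v (- y) = 0"
      using matrix_vector_mult_scaleR[of ?B "- 1" y] y by simp
    then have "y $ i \<le> 0" "(- y) $ i \<le> 0" for i
      using y nonpos by blast+
    then show ?thesis by (simp add: vec_eq_iff antisym)
  qed
  then have "invertible ?B"
    using invertible_left_inverse matrix_left_invertible_ker by blast
  then show ?thesis by (metis transpose_transpose transpose_invertible)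
qed

lemma matrix_inv_A_shift_mult:
  assumes "\<And>j. 0 \<le> u $ j"
  shows "A_shift k u *v (matrix_inv (A_shift k u) *v y) = y"
    and "matrix_inv (A_shift k u) *v (A_shift k u *v y) = y"
proof -
  let ?A = "A_shift k u"
  have "?A ** matrix_inv ?A = mat 1 \<and> matrix_inv ?A ** ?A = mat 1"
    unfolding matrix_inv_def
    by (rule someI_ex) (use invertible_A_shift[OF assms] in \<open>simp add: invertible_def\<close>)
  then show "?A *v (matrix_inv ?A *v y) = y" "matrix_inv ?A *v (?A *v y) = y"
    by (simp_all add: matrix_vector_mul_assoc)
qed

text \<open>
  The form of the inverse at \<open>w\<close> is the form of the matrix itself at \<open>v\<close>, where
  \<open>A z = diag u w\<close> and \<open>z = diag u v\<close>.  The second substitution is possible even if some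
  components of \<open>u\<close> vanish, because \<open>z\<close> vanishes there too.
\<close>

lemma inverse_quadratic_form_nonneg:
  assumes u: "\<And>j. 0 \<le> u $ j"
  shows "0 \<le> w \<bullet> (matrix_inv (A_shift k u) *v (diag_mat u *v w))"
proof -
  define z where "z = matrix_inv (A_shift k u) *v (diag_mat u *v w)"
  define v :: "real ^ 'n" where "v = (\<chi> i. z $ i / u $ i)"
  have Az: "A_shift k u *v z = diag_mat u *v w"
    by (simp add: z_def matrix_inv_A_shift_mult u)
  have "z $ i = 0" if i: "u $ i = 0" for i
  proof -
    obtain a where "0 < a" "(A_shift k u *v z) $ i = a * z $ i"
      using A_shift_at_zero[OF u i] by metis
    then show ?thesis
      by (simp add: Az diag_mat_mult i)
  qed
  then have z: "z = diag_mat u *v v"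
    by (auto simp: vec_eq_iff diag_mat_mult v_def)
  have "w \<bullet> z = v \<bullet> (diag_mat u *v w)"
    by (simp add: z inner_vec_def diag_mat_mult mult_ac)
  also have "\<dots> = v \<bullet> (A_shift k u *v (diag_mat u *v v))"
    by (simp add: Az[symmetric] z)
  finally show ?thesis
    using A_shift_quadratic_form_nonneg[OF u] by (simp add: z_def)
qed

end

lemma mobility_nonneg:
  fixes kappa :: "phase \<Rightarrow> 'n::finite \<Rightarrow> 'n \<Rightarrow> real"
  assumes "2 \<le> CARD('n)"
    and "\<And>\<alpha> i j. i \<noteq> j \<Longrightarrow> kappa \<alpha> i j = kappa \<alpha> j i"
    and "\<And>\<alpha> i j. i \<noteq> j \<Longrightarrow> 0 < kappa \<alpha> i j"
    and "\<And>j. 0 \<le> u $ j"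
  shows "0 \<le> w \<bullet> (M_hat kappa \<alpha> u *v w)"
  using assms
  by (cases \<alpha>) (simp_all add: M_hat_def matrix_vector_mul_assoc[symmetric]
      A_shift_quadratic_form_nonneg inverse_quadratic_form_nonneg)

section \<open>Logarithmic mean and entropy\<close>

lemma log_mean_nonneg: "0 \<le> log_mean a b"
proof (cases "min a b \<le> 0 \<or> a = b")
  case True
  then show ?thesis by (auto simp: log_mean_def)
next
  case False
  then have ab: "0 < a" "0 < b" "a \<noteq> b" by auto
  then have "0 < (a - b) / (ln a - ln b)"
    by (cases "a < b") (auto simp: divide_neg_neg)
  with ab show ?thesis by (simp add: log_mean_def)
qed

text \<open>
  The discrete chain rule that motivates the logarithmic mean.  If both arguments vanish it holds
  whatever the value of \<open>ln 0\<close>, and this is the only degenerate case that solutions meet.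
\<close>

lemma log_mean_mult_ln_diff:
  assumes "0 < a \<and> 0 < b \<or> a = 0 \<and> b = 0"
  shows "log_mean a b * (ln b - ln a) = b - a"
proof (cases "a = b")
  case False
  with assms have "0 < a" "0 < b" by auto
  with False have "ln a - ln b \<noteq> 0" by simp
  with False \<open>0 < a\<close> \<open>0 < b\<close> show ?thesis
    by (simp add: log_mean_def field_simps)
qed simp

text \<open>
  A convex function lies above its tangents; here this reduces to \<open>ln t \<le> t - 1\<close> with
  \<open>t = c / a\<close>.  At \<open>c = 0\<close> the derivative is infinite, hence the restriction on \<open>a\<close>.
\<close>

lemma entropy_tangent:
  fixes a c :: real
  assumes "0 \<le> a" "0 \<le> c" "c = 0 \<Longrightarrow> a = 0"
  shows "c * (ln c + m) - c + 1 + (ln c + m) * (a - c) \<le> a * (ln a + m) - a + 1"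
proof (cases "a = 0")
  case True
  with assms(2) show ?thesis by (simp add: algebra_simps)
next
  case False
  with assms have "0 < a" "0 < c" by (auto simp: less_le)
  then have "ln c - ln a \<le> c / a - 1"
    using ln_le_minus_one[of "c / a"] by (simp add: ln_div)
  then have "a * (ln c - ln a) \<le> a * (c / a - 1)"
    using \<open>0 < a\<close> by (simp add: mult_left_mono)
  also have "\<dots> = c - a" using \<open>0 < a\<close> by (simp add: field_simps)
  finally show ?thesis by (simp add: algebra_simps)
qed

lemma energy_density_tangent:
  fixes a c :: "real ^ 'n::finite"
  assumes "\<And>i. 0 \<le> a $ i" "\<And>i. 0 \<le> c $ i" "\<And>i. c $ i = 0 \<Longrightarrow> a $ i = 0"
  shows "energy_density mu \<alpha> c + (\<Sum>i\<in>UNIV. (ln (c $ i) + mu \<alpha> $ i) * (a $ i - c $ i))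
          \<le> energy_density mu \<alpha> a"
  unfolding energy_density_def sum.distrib[symmetric]
  by (intro sum_mono entropy_tangent) (use assms in auto)

text \<open>
  Add the tangent inequalities at the weighted mean \<open>y\<close>; the linear parts cancel.  A component of
  \<open>y\<close> can vanish only if it vanishes in both \<open>a\<close> and \<open>b\<close>, so the tangents are defined.
\<close>

lemma energy_density_jensen:
  fixes a b :: "real ^ 'n::finite"
  assumes p: "0 < p" and q: "0 < q"
    and a: "\<And>i. 0 \<le> a $ i" and b: "\<And>i. 0 \<le> b $ i"
  shows "(p + q) * energy_density mu \<alpha> ((1 / (p + q)) *\<^sub>R (p *\<^sub>R a + q *\<^sub>R b))
          \<le> p * energy_density mu \<alpha> a + q * energy_density mu \<alpha> b"
proof -
  define y where "y = (1 / (p + q)) *\<^sub>R (p *\<^sub>R a + q *\<^sub>R b)"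
  let ?l = "\<lambda>i. ln (y $ i) + mu \<alpha> $ i"
  have y: "(p + q) * y $ i = p * a $ i + q * b $ i" for i
    using p q by (simp add: y_def)
  have y0: "0 \<le> y $ i" for i
    using p q a b by (simp add: y_def)
  have "p * a $ i + q * b $ i = 0 \<Longrightarrow> a $ i = 0 \<and> b $ i = 0" for i
    using p q a[of i] b[of i] by (simp add: add_nonneg_eq_0_iff)
  then have zero: "y $ i = 0 \<Longrightarrow> a $ i = 0" "y $ i = 0 \<Longrightarrow> b $ i = 0" for i
    using y[of i] by auto
  have "p * (energy_density mu \<alpha> y + (\<Sum>i\<in>UNIV. ?l i * (a $ i - y $ i)))
        + q * (energy_density mu \<alpha> y + (\<Sum>i\<in>UNIV. ?l i * (b $ i - y $ i)))
      \<le> p * energy_density mu \<alpha> a + q * energy_density mu \<alpha> b"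
    using p q by (intro add_mono mult_left_mono energy_density_tangent) (auto simp: a b y0 zero)
  moreover have "p * (\<Sum>i\<in>UNIV. ?l i * (a $ i - y $ i)) + q * (\<Sum>i\<in>UNIV. ?l i * (b $ i - y $ i)) = 0"
  proof -
    have "p * (?l i * (a $ i - y $ i)) + q * (?l i * (b $ i - y $ i)) = 0" for i
      using arg_cong[OF y[of i], of "\<lambda>t. ?l i * t"] by (simp add: algebra_simps)
    then show ?thesis
      by (simp add: sum_distrib_left sum.distrib[symmetric])
  qed
  ultimately show ?thesis
    unfolding y_def[symmetric] by (simp only: distrib_left distrib_right)
qed

section \<open>One step of the scheme\<close>

lemma beta_pos: "0 < sqrt (beta mu i)"
  by (simp add: beta_def)

text \<open>
  Both exchange coefficients are below the constant in the time-step restriction, because their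
  sum is exactly the hyperbolic cosine in its definition.
\<close>

lemma time_step_const_ge:
  fixes mu :: "phase \<Rightarrow> real ^ 'n::finite"
  shows "sqrt (beta mu i) + 1 / sqrt (beta mu i) \<le> time_step_const mu"
proof -
  let ?t = "1 / 2 * (mu Gas $ i - mu Solid $ i)"
  have "sqrt (beta mu i) = exp ?t"
    unfolding beta_def
    by (rule real_sqrt_unique) (simp_all add: power2_eq_square exp_add[symmetric])
  then have "sqrt (beta mu i) + 1 / sqrt (beta mu i) = 2 * cosh ?t"
    by (simp only: cosh_field_def exp_minus inverse_eq_divide) simp
  also have "\<dots> \<le> time_step_const mu"
    unfolding time_step_const_def by (rule Max_ge) auto
  finally show ?thesis .
qed

locale scheme_step =
  fixes kappa :: "phase \<Rightarrow> 'n::finite \<Rightarrow> 'n \<Rightarrow> real"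
    and mu :: "phase \<Rightarrow> real ^ 'n"
    and T :: "real ^ 'n \<Rightarrow> real ^ 'n"
    and N :: nat and dt :: real
    and c0 cs J :: "nat \<Rightarrow> real ^ 'n"
    and X0 Xt :: real
  assumes species: "2 \<le> CARD('n)"
    and kappa_sym: "\<And>\<alpha> i j. i \<noteq> j \<Longrightarrow> kappa \<alpha> i j = kappa \<alpha> j i"
    and kappa_pos: "\<And>\<alpha> i j. i \<noteq> j \<Longrightarrow> 0 < kappa \<alpha> i j"
    and T: "truncation_map T"
    and T_sum: "\<And>x. (\<Sum>i\<in>UNIV. x $ i) = 1 \<Longrightarrow> (\<Sum>i\<in>UNIV. T x $ i) \<le> 1"
    and dt: "0 < dt" "dt < (1 / real N) / (2 * time_step_const mu)"
    and c0: "\<And>K. K \<in> {1..N} \<Longrightarrow> c0 K \<in> composition_simplex"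
    and X0: "0 < X0" "X0 < 1"
    and L: "1 < interface_index N X0" "interface_index N X0 < N"
    and scheme: "modified_scheme kappa mu T N dt c0 X0 cs Xt J"
begin

abbreviation L where "L \<equiv> interface_index N X0"
abbreviation d0 where "d0 \<equiv> moved_size N L X0"
abbreviation d where "d \<equiv> moved_size N L Xt"
abbreviation rate where "rate \<equiv> interface_rate mu (T (cs L)) (T (cs (L + 1)))"
abbreviation mass where "mass K \<equiv> (\<Sum>i\<in>UNIV. cs K $ i)"

section \<open>Total mass and positivity of the cell sizes\<close>

lemma N_pos: "0 < real N"
  using L by simp

lemma dx_pos: "0 < 1 / real N"
  using N_pos by simp

lemma c0_nonneg: "K \<in> {1..N} \<Longrightarrow> 0 \<le> c0 K $ i"
  and c0_sum: "K \<in> {1..N} \<Longrightarrow> (\<Sum>i\<in>UNIV. c0 K $ i) = 1"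
  using c0 by (auto simp: composition_simplex_def)

lemma Xt: "0 \<le> Xt" "Xt \<le> 1" "Xt = X0 + dt * (\<Sum>i\<in>UNIV. rate $ i)"
  and J_boundary: "J 0 = 0" "J N = 0"
  and solid_flux: "\<And>K. 1 \<le> K \<Longrightarrow> K < L \<Longrightarrow>
      (1 / real N) *\<^sub>R J K = - (A_shift (kappa Solid) (edge_value cs K) *v D_edge cs K)"
  and gas_flux: "\<And>K. L < K \<Longrightarrow> K \<le> N - 1 \<Longrightarrow>
      (1 / real N) *\<^sub>R (A_shift (kappa Gas) (edge_value cs K) *v J K) = - D_edge cs K"
  using scheme unfolding modified_scheme_def Let_def by simp_all

lemma conservation:
  assumes "K \<in> {1..N}"
  shows "d K * cs K $ i - d0 K * c0 K $ i
    + dt * ((if K = L then - (mass L * rate $ i) else J K $ i)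
            - (if K = L + 1 then - (mass (L + 1) * rate $ i) else J (K - 1) $ i)) = 0"
proof -
  have "\<forall>K\<in>{1..N}. \<forall>i. 1 / dt * (d K * cs K $ i - d0 K * c0 K $ i)
      + (if K = L then - mass K *\<^sub>R rate else J K) $ i
      - (if K = L + 1 then - mass K *\<^sub>R rate else J (K - 1)) $ i = 0"
    using scheme unfolding modified_scheme_def Let_def cell_size_def by blast
  with assms have "1 / dt * (d K * cs K $ i - d0 K * c0 K $ i)
      + (if K = L then - mass K *\<^sub>R rate else J K) $ i
      - (if K = L + 1 then - mass K *\<^sub>R rate else J (K - 1)) $ i = 0"
    by blast
  then show ?thesis
    using dt(1) by (auto simp: field_simps split: if_splits)
qed

lemma d_eq:
  "d K = d0 K + (if K = L then dt * (\<Sum>i\<in>UNIV. rate $ i) else 0)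
              - (if K = L + 1 then dt * (\<Sum>i\<in>UNIV. rate $ i) else 0)"
  using moved_size_diff[of N L Xt K X0] Xt(3) by (auto split: if_splits)

lemma X0_close: "2 * \<bar>edge_pos N L - X0\<bar> \<le> 1 / real N"
  using interface_index_close[of N X0] L X0 by simp

lemma d0_pos: "0 < d0 K"
proof (rule moved_size_pos)
  show "\<bar>X0 - edge_pos N L\<bar> < 1 / real N"
    using X0_close dx_pos unfolding abs_minus_commute[of X0] by argo
qed (use L N_pos in auto)

text \<open>
  Summed over the species, the fluxes away from the interface follow a scalar Fick law.
\<close>

lemma sum_flux:
  assumes "K \<in> {1..N-1}" "K \<noteq> L"
  obtains a where "0 < a" "(\<Sum>i\<in>UNIV. J K $ i) = - a * (mass (K + 1) - mass K)"
proof (cases "K < L")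
  case True
  let ?k = "kappa_min (kappa Solid)"
  have k: "0 < ?k" by (rule kappa_min_pos[OF species kappa_sym kappa_pos])
  have "(\<Sum>i\<in>UNIV. ((1 / real N) *\<^sub>R J K) $ i) = - (?k * (\<Sum>i\<in>UNIV. D_edge cs K $ i))"
    using True assms
    by (simp add: solid_flux sum_negf sum_A_shift[OF species kappa_sym kappa_pos])
  then have "(\<Sum>i\<in>UNIV. J K $ i) = - (?k * real N) * (mass (K + 1) - mass K)"
    using N_pos by (simp add: D_edge_def sum_subtractf sum_divide_distrib[symmetric] field_simps)
  with k N_pos show ?thesis by (intro that[of "?k * real N"]) auto
next
  case False
  let ?k = "kappa_min (kappa Gas)"
  have k: "0 < ?k" by (rule kappa_min_pos[OF species kappa_sym kappa_pos])
  have "(1 / real N) * (?k * (\<Sum>i\<in>UNIV. J K $ i))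
      = (\<Sum>i\<in>UNIV. ((1 / real N) *\<^sub>R (A_shift (kappa Gas) (edge_value cs K) *v J K)) $ i)"
    by (simp add: sum_A_shift[OF species kappa_sym kappa_pos] sum_divide_distrib[symmetric])
  also have "\<dots> = - (mass (K + 1) - mass K)"
    using False assms gas_flux[of K] by (simp add: D_edge_def sum_subtractf)
  finally have "(\<Sum>i\<in>UNIV. J K $ i) = - (real N / ?k) * (mass (K + 1) - mass K)"
    using N_pos k by (simp add: field_simps)
  with k N_pos show ?thesis by (intro that[of "real N / ?k"]) auto
qed

text \<open>
  At the interface, the change of the cell size exactly absorbs the exchanged mass:
  \<open>d L * mass L\<close> minus the exchanged amount is \<open>d0 L * mass L\<close>, and likewise on the gas side.  The
  deviation \<open>mass K - 1\<close> thus solves a homogeneous discrete heat equation on the old mesh, with no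
  flux through the interface, and vanishes.  Only the sizes \<open>d0\<close> enter; the positivity of \<open>d\<close>
  is a consequence of this lemma.
\<close>

lemma mass_one:
  assumes "K \<in> {1..N}"
  shows "mass K = 1"
proof -
  \<comment> \<open>Interface contributions are absorbed in the storage term, so the edge \<open>L\<close> carries no flux.\<close>
  define j where "j K = (if K = L then 0 else dt * (\<Sum>i\<in>UNIV. J K $ i))" for K
  have "(mass K - 1) * (d0 K * (mass K - 1)) = 0"
  proof (rule balanced_test_zero[where G = j and N = N])
    show "j 0 = 0" "j N = 0"
      using L J_boundary by (simp_all add: j_def)
    show "K \<in> {1..N}" by (rule assms)
    fix K
    show "0 \<le> (mass K - 1) * (d0 K * (mass K - 1))"
      using d0_pos[of K] by (simp add: mult.left_commute)
    {
      assume K: "K \<in> {1..N}"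
      let ?r = "\<Sum>i\<in>UNIV. rate $ i"
      let ?fr = "if K = L then - (mass L * ?r) else \<Sum>i\<in>UNIV. J K $ i"
      let ?fl = "if K = L + 1 then - (mass (L + 1) * ?r) else \<Sum>i\<in>UNIV. J (K - 1) $ i"
      have "(\<Sum>i\<in>UNIV. d K * cs K $ i - d0 K * c0 K $ i
          + dt * ((if K = L then - (mass L * rate $ i) else J K $ i)
            - (if K = L + 1 then - (mass (L + 1) * rate $ i) else J (K - 1) $ i))) = 0"
        using conservation[OF K] by simp
      then have "d K * mass K - d0 K + dt * (?fr - ?fl) = 0"
        using K by (auto simp: sum.distrib sum_subtractf sum_distrib_left[symmetric] c0_sum
            sum_negf split: if_splits)
      then show "d0 K * (mass K - 1) + j K - j (K - 1) = 0"
        using K L by (auto simp: d_eq j_def algebra_simps split: if_splits)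
    }
    assume K: "K \<in> {1..N-1}"
    show "j K * ((mass (K + 1) - 1) - (mass K - 1)) \<le> 0"
    proof (cases "K = L")
      case False
      then obtain a where "0 < a" "(\<Sum>i\<in>UNIV. J K $ i) = - a * (mass (K + 1) - mass K)"
        using sum_flux K by metis
      then have "j K * ((mass (K + 1) - 1) - (mass K - 1)) = - (dt * a * (mass (K + 1) - mass K)^2)"
        using False by (simp add: j_def power2_eq_square)
      with \<open>0 < a\<close> dt(1) show ?thesis by simp
    qed (simp add: j_def)
  qed
  then show ?thesis using d0_pos[of K] by simp
qed

lemma time_step_const_pos: "0 < time_step_const mu"
proof -
  fix i :: 'n
  have "0 < sqrt (beta mu i)" "0 < 1 / sqrt (beta mu i)"
    by (simp_all add: beta_pos del: real_sqrt_gt_0_iff)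
  with time_step_const_ge[of mu i] show ?thesis by linarith
qed

text \<open>
  The rate is a difference of two nonnegative sums.  Each is at most the largest exchange
  coefficient, because the truncated compositions have mass at most one.
\<close>

lemma rate_sum_bound: "\<bar>\<Sum>i\<in>UNIV. rate $ i\<bar> \<le> time_step_const mu"
proof -
  let ?C = "time_step_const mu"
  define b where "b i = sqrt (beta mu i)" for i
  define s where "s = T (cs L)"
  define g where "g = T (cs (L + 1))"
  have s: "0 \<le> s $ i" "(\<Sum>i\<in>UNIV. s $ i) \<le> 1" and g: "0 \<le> g $ i" "(\<Sum>i\<in>UNIV. g $ i) \<le> 1" for i
    using T T_sum mass_one[of L] mass_one[of "L + 1"] L
    by (auto simp: s_def g_def truncation_map_def)
  have b_pos: "0 < b i" for i unfolding b_def by (rule beta_pos)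
  have C: "b i \<le> ?C" "1 / b i \<le> ?C" for i
  proof -
    have "b i + 1 / b i \<le> ?C" unfolding b_def by (rule time_step_const_ge)
    moreover have "0 < 1 / b i" using b_pos by simp
    ultimately show "b i \<le> ?C" "1 / b i \<le> ?C" using b_pos[of i] by linarith+
  qed
  have "(\<Sum>i\<in>UNIV. b i * g $ i) \<le> (\<Sum>i\<in>UNIV. ?C * g $ i)"
    using C g by (intro sum_mono mult_right_mono)
  also have "\<dots> \<le> ?C"
    using g time_step_const_pos by (simp add: sum_distrib_left[symmetric] mult_left_le less_imp_le)
  finally have G: "(\<Sum>i\<in>UNIV. b i * g $ i) \<le> ?C" .
  have "(\<Sum>i\<in>UNIV. 1 / b i * s $ i) \<le> (\<Sum>i\<in>UNIV. ?C * s $ i)"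
    using C s by (intro sum_mono mult_right_mono)
  also have "\<dots> \<le> ?C"
    using s time_step_const_pos by (simp add: sum_distrib_left[symmetric] mult_left_le less_imp_le)
  finally have S: "(\<Sum>i\<in>UNIV. 1 / b i * s $ i) \<le> ?C" .
  have "0 \<le> (\<Sum>i\<in>UNIV. b i * g $ i)" "0 \<le> (\<Sum>i\<in>UNIV. 1 / b i * s $ i)"
    using b_pos g s by (auto intro!: sum_nonneg simp: less_imp_le)
  moreover have "(\<Sum>i\<in>UNIV. rate $ i) = (\<Sum>i\<in>UNIV. b i * g $ i) - (\<Sum>i\<in>UNIV. 1 / b i * s $ i)"
    by (simp add: interface_rate_def b_def s_def g_def sum_subtractf)
  ultimately show ?thesis using G S by linarith
qed

lemma Xt_close: "2 * \<bar>Xt - X0\<bar> < 1 / real N"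
proof -
  have "2 * \<bar>Xt - X0\<bar> = 2 * dt * \<bar>\<Sum>i\<in>UNIV. rate $ i\<bar>"
    using Xt(3) dt(1) by (simp add: abs_mult)
  also have "\<dots> \<le> 2 * dt * time_step_const mu"
    using rate_sum_bound dt(1) by (simp add: mult_left_mono)
  also have "\<dots> < 1 / real N"
    using dt(2) time_step_const_pos N_pos by (simp add: field_simps)
  finally show ?thesis .
qed

lemma d_pos: "0 < d K"
proof (rule moved_size_pos)
  show "\<bar>Xt - edge_pos N L\<bar> < 1 / real N"
    using X0_close Xt_close by (smt (verit) field_sum_of_halves)
qed (use L N_pos in auto)

section \<open>Nonnegativity and absent species\<close>

text \<open>
  With total mass one, the interface fluxes seen from the two sides coincide, so that all edges can
  be treated together.
\<close>

definition flux :: "nat \<Rightarrow> real ^ 'n" where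
  "flux K = (if K = L then - rate else J K)"

lemma flux_boundary: "flux 0 = 0" "flux N = 0"
  using L J_boundary by (auto simp: flux_def)

lemma balance:
  assumes K: "K \<in> {1..N}"
  shows "d K * cs K $ i - d0 K * c0 K $ i + dt * flux K $ i - dt * flux (K - 1) $ i = 0"
  using conservation[OF K, of i] mass_one[of L] mass_one[of "L + 1"] L K
  by (auto simp: flux_def algebra_simps split: if_splits)

lemma edge_value_nonneg: "0 \<le> edge_value cs K $ i"
  by (simp add: edge_value_def log_mean_nonneg)

lemma degenerate_edge:
  assumes K: "K \<in> {1..N-1}" "K \<noteq> L" and i: "cs K $ i \<le> 0 \<or> cs (K + 1) $ i \<le> 0"
  obtains a where "0 < a" "flux K $ i = - a * (cs (K + 1) $ i - cs K $ i)"
proof -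
  have e: "edge_value cs K $ i = 0"
    using i by (auto simp: edge_value_def log_mean_def)
  have row: "\<exists>a>0. \<forall>x. (A_shift (kappa \<alpha>) (edge_value cs K) *v x) $ i = a * x $ i" for \<alpha>
    using A_shift_at_zero[where k = "kappa \<alpha>" and u = "edge_value cs K" and i = i,
        OF species kappa_sym kappa_pos edge_value_nonneg e] by blast
  show ?thesis
  proof (cases "K < L")
    case True
    obtain a where a: "0 < a"
      "\<And>x. (A_shift (kappa Solid) (edge_value cs K) *v x) $ i = a * x $ i"
      using row[of Solid] by blast
    have "((1 / real N) *\<^sub>R J K) $ i = - (a * D_edge cs K $ i)"
      using True K solid_flux[of K] a(2) by simp
    then have "flux K $ i = - (a * real N) * (cs (K + 1) $ i - cs K $ i)"
      using N_pos K by (simp add: flux_def D_edge_def field_simps)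
    with a(1) N_pos show ?thesis by (intro that[of "a * real N"]) auto
  next
    case False
    obtain a where a: "0 < a"
      "\<And>x. (A_shift (kappa Gas) (edge_value cs K) *v x) $ i = a * x $ i"
      using row[of Gas] by blast
    from False K have "L < K" "K \<le> N - 1" by auto
    from arg_cong[OF gas_flux[OF this], of "\<lambda>v. v $ i"]
    have "(1 / real N) * (a * J K $ i) = - (D_edge cs K $ i)"
      by (simp add: a(2))
    then have "flux K $ i = - (real N / a) * (cs (K + 1) $ i - cs K $ i)"
      using N_pos K a(1) by (simp add: flux_def D_edge_def field_simps)
    with a(1) N_pos show ?thesis by (intro that[of "real N / a"]) auto
  qed
qed

lemma T_cs:
  assumes "K \<in> {1..N}"
  shows "0 \<le> T (cs K) $ i" "T (cs K) $ i = 0 \<longleftrightarrow> cs K $ i \<le> 0"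
  using T mass_one[OF assms] by (auto simp: truncation_map_def)

text \<open>
  Test with the negative part of species \<open>i\<close>.  Where that is nonzero at one end of an edge, the edge
  value vanishes and the flux is a positive multiple of \<open>-D c\<close>, hence dissipative.  At the
  interface, the truncation removes the outflow from a cell of nonpositive content.
\<close>

lemma cs_nonneg:
  assumes K: "K \<in> {1..N}"
  shows "0 \<le> cs K $ i"
proof -
  define m where "m K = min (cs K $ i) 0" for K
  define a where "a K = d K * cs K $ i - d0 K * c0 K $ i" for K
  have ma: "m K * a K = d K * (m K)^2 + (- m K) * (d0 K * c0 K $ i)" for K
    by (cases "cs K $ i \<le> 0") (auto simp: m_def a_def power2_eq_square algebra_simps)
  have pos: "0 \<le> (- m K) * (d0 K * c0 K $ i)" if "K \<in> {1..N}" for K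
    using that d0_pos[of K] c0_nonneg[of K i] by (intro mult_nonneg_nonneg) (auto simp: m_def)
  have "m K * a K = 0"
  proof (rule balanced_test_zero[where G = "\<lambda>K. dt * flux K $ i" and N = N])
    show "dt * flux 0 $ i = 0" "dt * flux N $ i = 0" by (simp_all add: flux_boundary)
    show "K \<in> {1..N}" by (rule K)
    fix K
    show "a K + dt * flux K $ i - dt * flux (K - 1) $ i = 0" if "K \<in> {1..N}"
      using balance[OF that] by (simp add: a_def)
    show "0 \<le> m K * a K" if "K \<in> {1..N}"
      unfolding ma using pos[OF that] d_pos[of K]
      by (intro add_nonneg_nonneg) simp_all
    assume K: "K \<in> {1..N-1}"
    have "flux K $ i * (m (K + 1) - m K) \<le> 0"
    proof (cases "K = L")
      case True
      let ?b = "sqrt (beta mu i)"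
      let ?g = "?b * T (cs (L + 1)) $ i" and ?s = "1 / ?b * T (cs L) $ i"
      have "L \<in> {1..N}" "L + 1 \<in> {1..N}" using L by auto
      note T' = T_cs[OF this(1), of i] T_cs[OF this(2), of i]
      have g: "0 \<le> ?g" "?g * m (L + 1) = 0" and s: "0 \<le> ?s" "?s * m L = 0"
        using T' beta_pos[of mu i] by (auto simp: m_def min_def)
      have "flux K $ i * (m (K + 1) - m K) = (?s - ?g) * (m (L + 1) - m L)"
        using True by (simp add: flux_def interface_rate_def)
      also have "\<dots> = ?s * m (L + 1) + ?g * m L - ?g * m (L + 1) - ?s * m L"
        by (simp only: left_diff_distrib right_diff_distrib)
      also have "\<dots> = ?s * m (L + 1) + ?g * m L"
        unfolding g(2) s(2) by simp
      also have "\<dots> \<le> 0"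
        using g(1) s(1) by (intro add_nonpos_nonpos mult_nonneg_nonpos) (auto simp: m_def)
      finally show ?thesis .
    next
      case False
      show ?thesis
      proof (cases "cs K $ i \<le> 0 \<or> cs (K + 1) $ i \<le> 0")
        case True
        obtain a where a: "0 < a" "flux K $ i = - a * (cs (K + 1) $ i - cs K $ i)"
          using degenerate_edge[OF K False True] by metis
        have "0 \<le> (cs (K + 1) $ i - cs K $ i) * (m (K + 1) - m K)"
          by (auto simp: m_def min_def zero_le_mult_iff)
        then show ?thesis
          using a(1) unfolding a(2) by (simp add: mult.assoc)
      qed (simp add: m_def)
    qed
    then show "dt * flux K $ i * (m (K + 1) - m K) \<le> 0"
      using dt(1) by (simp add: mult.assoc mult_nonneg_nonpos)
  qed
  then have "d K * (m K)^2 = 0"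
    using ma[of K] pos[OF K] d_pos[of K] by (smt (verit) mult_nonneg_nonneg zero_le_power2)
  then show ?thesis
    using d_pos[of K] by (auto simp: m_def)
qed

lemma rate_eq: "rate = interface_rate mu (cs L) (cs (L + 1))"
proof -
  have "T (cs K) = cs K" if "K \<in> {1..N}" for K
    using T that mass_one cs_nonneg by (auto simp: truncation_map_def composition_simplex_def)
  from this[of L] this[of "L + 1"] show ?thesis using L by simp
qed

lemma flux_interface:
  "flux L $ i = 1 / sqrt (beta mu i) * cs L $ i - sqrt (beta mu i) * cs (L + 1) $ i"
proof -
  have "flux L = - interface_rate mu (cs L) (cs (L + 1))"
    using rate_eq by (simp add: flux_def)
  then show ?thesis by (simp add: interface_rate_def)
qed

text \<open>
  On every edge next to an empty cell, the interface included, the flux is a combination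
  \<open>b * c K - a * c (K + 1)\<close> with positive coefficients, as \<open>zero_spreads\<close> requires.
\<close>

lemma species_absent:
  assumes "M \<in> {1..N}" "cs M $ i = 0" "K \<in> {1..N}"
  shows "cs K $ i = 0" "c0 K $ i = 0"
proof -
  have "cs K $ i = 0 \<and> d0 K * c0 K $ i = 0"
  proof (rule zero_spreads[where G = "\<lambda>K. dt * flux K $ i" and N = N])
    show "dt * flux 0 $ i = 0" "dt * flux N $ i = 0" by (simp_all add: flux_boundary)
    show "M \<in> {1..N}" "cs M $ i = 0" "K \<in> {1..N}" by (rule assms)+
    fix K
    show "d K * cs K $ i - d0 K * c0 K $ i + dt * flux K $ i - dt * flux (K - 1) $ i = 0"
      if "K \<in> {1..N}" by (rule balance[OF that])
    show "0 \<le> d0 K * c0 K $ i" if "K \<in> {1..N}"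
      using that d0_pos[of K] c0_nonneg by (simp add: less_imp_le)
    assume "K \<in> {1..N-1}"
    then have nonneg: "0 \<le> cs K $ i" "0 \<le> cs (K + 1) $ i"
      by (auto intro!: cs_nonneg)
    have edge: "\<exists>a b. 0 < a \<and> 0 < b \<and> flux K $ i = b * cs K $ i - a * cs (K + 1) $ i"
      if zero: "cs K $ i = 0 \<or> cs (K + 1) $ i = 0"
    proof (cases "K = L")
      case True
      then show ?thesis
        using flux_interface[of i] beta_pos[of mu i] by (metis zero_less_divide_1_iff)
    next
      case False
      from zero have "cs K $ i \<le> 0 \<or> cs (K + 1) $ i \<le> 0" by auto
      then obtain a where "0 < a" "flux K $ i = - a * (cs (K + 1) $ i - cs K $ i)"
        using degenerate_edge[OF \<open>K \<in> {1..N-1}\<close> False] by metis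
      then have "0 < a \<and> 0 < a \<and> flux K $ i = a * cs K $ i - a * cs (K + 1) $ i"
        by (simp add: algebra_simps)
      then show ?thesis by blast
    qed
    show "dt * flux K $ i \<le> 0 \<and> (dt * flux K $ i = 0 \<longrightarrow> cs (K + 1) $ i = 0)" if "cs K $ i = 0"
      using edge that nonneg dt(1) by (auto simp: mult_le_0_iff)
    show "0 \<le> dt * flux K $ i \<and> (dt * flux K $ i = 0 \<longrightarrow> cs K $ i = 0)" if "cs (K + 1) $ i = 0"
      using edge that nonneg dt(1) by (auto simp: zero_le_mult_iff)
  qed
  then show "cs K $ i = 0" "c0 K $ i = 0" using d0_pos[of K] by auto
qed

lemma positive_or_absent:
  assumes "K \<in> {1..N}" "M \<in> {1..N}"
  shows "0 < cs K $ i \<and> 0 < cs M $ i \<or> cs K $ i = 0 \<and> cs M $ i = 0"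
  using species_absent(1) cs_nonneg assms by (metis less_le)

section \<open>The energy balance on the moving mesh\<close>

abbreviation log_jump where "log_jump K \<equiv> D_edge (\<lambda>K. vec_log (cs K)) K"
abbreviation mobility where "mobility K \<equiv> M_hat kappa (phase_of_cell N X0 K) (edge_value cs K)"

lemma D_edge_eq:
  assumes K: "K \<in> {1..N-1}"
  shows "D_edge cs K = diag_mat (edge_value cs K) *v log_jump K"
proof -
  have "0 < cs K $ i \<and> 0 < cs (K + 1) $ i \<or> cs K $ i = 0 \<and> cs (K + 1) $ i = 0" for i
    using K by (intro positive_or_absent) auto
  then show ?thesis
    by (simp add: vec_eq_iff D_edge_def diag_mat_mult edge_value_def vec_log_def
        log_mean_mult_ln_diff)
qed

lemma flux_mobility:
  assumes K: "K \<in> {1..N-1}" "K \<noteq> L"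
  shows "(1 / real N) *\<^sub>R J K = - (mobility K *v log_jump K)"
proof (cases "K < L")
  case True
  then show ?thesis
    using K solid_flux[of K]
    by (simp add: M_hat_def phase_of_cell_def D_edge_eq matrix_vector_mul_assoc)
next
  case False
  let ?A = "A_shift (kappa Gas) (edge_value cs K)"
  have "?A *v ((1 / real N) *\<^sub>R J K) = - D_edge cs K"
    using False K gas_flux[of K] by (simp add: matrix_vector_mult_scaleR)
  moreover have "matrix_inv ?A *v (?A *v y) = y" for y
    by (rule matrix_inv_A_shift_mult(2))
       (use species kappa_sym kappa_pos edge_value_nonneg in auto)
  ultimately have "(1 / real N) *\<^sub>R J K = matrix_inv ?A *v (- D_edge cs K)"
    by metis
  then show ?thesis
    using False K
    by (simp add: M_hat_def phase_of_cell_def D_edge_eq matrix_vector_mul_assoc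
        linear_neg[OF matrix_vector_mul_linear])
qed

abbreviation dissipation where
  "dissipation \<equiv> dt / (1 / real N) * (\<Sum>K\<in>{1..N-1} - {L}. log_jump K \<bullet> (mobility K *v log_jump K))"

abbreviation exchange where
  "exchange \<equiv> dt * (\<Sum>i\<in>UNIV. interface_rate mu (cs L) (cs (L + 1)) $ i *
     ((ln (cs (L + 1) $ i) + mu Gas $ i) - (ln (cs L $ i) + mu Solid $ i)))"

lemma dissipation_nonneg: "0 \<le> dissipation"
  using dt(1) by (intro mult_nonneg_nonneg sum_nonneg
      mobility_nonneg[OF species kappa_sym kappa_pos edge_value_nonneg]) auto

text \<open>
  The rate is a positive multiple of \<open>beta * g - s\<close> and the jump of chemical potential is
  \<open>ln (beta * g) - ln s\<close>, where \<open>s\<close> and \<open>g\<close> are the concentrations on the solid and gas sides;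
  these have the same sign.  For an absent species the rate vanishes.
\<close>

lemma exchange_nonneg: "0 \<le> exchange"
proof -
  have "0 \<le> interface_rate mu (cs L) (cs (L + 1)) $ i *
     ((ln (cs (L + 1) $ i) + mu Gas $ i) - (ln (cs L $ i) + mu Solid $ i))" for i
  proof -
    have "0 < cs L $ i \<and> 0 < cs (L + 1) $ i \<or> cs L $ i = 0 \<and> cs (L + 1) $ i = 0"
      using L by (intro positive_or_absent) auto
    then consider "cs L $ i = 0" "cs (L + 1) $ i = 0" | "0 < cs L $ i" "0 < cs (L + 1) $ i"
      by blast
    then show ?thesis
    proof cases
      case 1
      then show ?thesis by (simp add: interface_rate_def)
    next
      case 2
      let ?b = "sqrt (beta mu i)" and ?s = "cs L $ i" and ?g = "cs (L + 1) $ i"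
      have b: "0 < ?b" "?b * ?b = beta mu i" by (simp_all add: beta_def)
      have rate: "interface_rate mu (cs L) (cs (L + 1)) $ i = (beta mu i * ?g - ?s) / ?b"
      proof -
        have "x * ?g - 1 / x * ?s = (x * x * ?g - ?s) / x" if "0 < x" for x :: real
          using that by (simp add: diff_divide_distrib)
        from this[OF b(1)] show ?thesis
          unfolding b(2) by (simp add: interface_rate_def)
      qed
      have pos: "0 < beta mu i * ?g" using 2 by (simp add: beta_def)
      have ln: "(ln ?g + mu Gas $ i) - (ln ?s + mu Solid $ i) = ln (beta mu i * ?g) - ln ?s"
        using 2 by (simp add: beta_def ln_mult)
      have "0 \<le> (beta mu i * ?g - ?s) * (ln (beta mu i * ?g) - ln ?s)"
        using 2(1) pos by (auto simp: zero_le_mult_iff)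
      then show ?thesis
        unfolding rate ln using b(1) by (simp add: zero_le_divide_iff)
    qed
  qed
  then show ?thesis using dt(1) by (simp add: sum_nonneg)
qed

text \<open>
  The energy after the transport step and before post-processing: the new interface position is in
  the sizes, while the phases are still those of the old index.
\<close>

definition intermediate_energy :: real where
  "intermediate_energy = (\<Sum>K=1..N. d K * energy_density mu (phase_of_cell N X0 K) (cs K))"

text \<open>
  The entropy estimate on the moving mesh: convexity in each cell, then summation by parts.
\<close>

lemma intermediate_energy_le:
  "intermediate_energy + dissipation + exchange \<le> free_energy mu N c0 X0"
proof -
  define h where "h K = energy_density mu (phase_of_cell N X0 K) (cs K)" for K
  define p where "p K = (\<chi> i. ln (cs K $ i) + mu (phase_of_cell N X0 K) $ i)" for K
  have tangent: "d K * h K - d0 K * energy_density mu (phase_of_cell N X0 K) (c0 K)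
      \<le> (d K - d0 K) * (real CARD('n) - 1) + p K \<bullet> (d K *\<^sub>R cs K - d0 K *\<^sub>R c0 K)"
    if K: "K \<in> {1..N}" for K
  proof -
    have "h K + p K \<bullet> (c0 K - cs K) \<le> energy_density mu (phase_of_cell N X0 K) (c0 K)"
      using energy_density_tangent[of "c0 K" "cs K" mu "phase_of_cell N X0 K"]
        c0_nonneg[OF K] cs_nonneg[OF K] species_absent(2)[OF K _ K]
      by (simp add: h_def p_def inner_vec_def)
    then have "d0 K * (h K + p K \<bullet> (c0 K - cs K))
        \<le> d0 K * energy_density mu (phase_of_cell N X0 K) (c0 K)"
      using d0_pos[of K] by (simp add: mult_left_mono)
    \<comment> \<open>The constant is the same in all cells only because every cell has total mass one.\<close>
    moreover have "h K = p K \<bullet> cs K + (real CARD('n) - 1)"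
      using mass_one[OF K]
      by (simp add: h_def p_def energy_density_def inner_vec_def sum.distrib sum_subtractf mult.commute)
    ultimately show ?thesis
      unfolding inner_diff_right inner_scaleR_right by (simp only: ring_distribs)
  qed
  have "intermediate_energy - free_energy mu N c0 X0
      = (\<Sum>K=1..N. d K * h K - d0 K * energy_density mu (phase_of_cell N X0 K) (c0 K))"
    by (simp add: intermediate_energy_def free_energy_def h_def sum_subtractf cell_size_def)
  also have "\<dots> \<le> (\<Sum>K=1..N. (d K - d0 K) * (real CARD('n) - 1)
      + p K \<bullet> (d K *\<^sub>R cs K - d0 K *\<^sub>R c0 K))"
    by (intro sum_mono tangent)
  \<comment> \<open>The sizes on both meshes have the same sum, so the constant terms cancel.\<close>
  also have "\<dots> = (\<Sum>K=1..N. p K \<bullet> (d K *\<^sub>R cs K - d0 K *\<^sub>R c0 K))"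
    using L sum_moved_size[of L N Xt X0]
    by (simp add: sum.distrib sum_distrib_right[symmetric] sum_subtractf)
  also have "\<dots> = (\<Sum>K=1..N. - (dt * (\<Sum>i\<in>UNIV. p K $ i * (flux K $ i - flux (K - 1) $ i))))"
  proof (rule sum.cong)
    fix K assume K: "K \<in> {1..N}"
    have "d K * cs K $ i - d0 K * c0 K $ i = - (dt * (flux K $ i - flux (K - 1) $ i))" for i
      using balance[OF K, of i] by (simp add: algebra_simps)
    then have "d K *\<^sub>R cs K - d0 K *\<^sub>R c0 K = - (dt *\<^sub>R (flux K - flux (K - 1)))"
      by (simp add: vec_eq_iff)
    then show "p K \<bullet> (d K *\<^sub>R cs K - d0 K *\<^sub>R c0 K)
        = - (dt * (\<Sum>i\<in>UNIV. p K $ i * (flux K $ i - flux (K - 1) $ i)))"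
      by (simp add: inner_vec_def sum_negf sum_distrib_left mult.left_commute)
  qed simp
  also have "\<dots> = - (dt * (\<Sum>i\<in>UNIV. \<Sum>K=1..N. p K $ i * (flux K $ i - flux (K - 1) $ i)))"
    by (subst sum.swap) (simp add: sum_negf sum_distrib_left)
  also have "\<dots> = dt * (\<Sum>i\<in>UNIV. \<Sum>K=1..N-1. flux K $ i * (p (K + 1) $ i - p K $ i))"
    by (subst summation_by_parts) (simp_all add: flux_boundary sum_negf)
  also have "\<dots> = dt * (\<Sum>K=1..N-1. flux K \<bullet> (p (K + 1) - p K))"
    by (subst sum.swap) (simp add: inner_vec_def)
  also have "\<dots> = dt * (flux L \<bullet> (p (L + 1) - p L))
      + dt * (\<Sum>K\<in>{1..N-1} - {L}. flux K \<bullet> (p (K + 1) - p K))"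
    using L by (subst sum.remove[of _ L]) (auto simp: distrib_left)
  also have "dt * (flux L \<bullet> (p (L + 1) - p L)) = - exchange"
    using rate_eq by (simp add: flux_def inner_vec_def p_def phase_of_cell_def sum_negf)
  also have "dt * (\<Sum>K\<in>{1..N-1} - {L}. flux K \<bullet> (p (K + 1) - p K)) = - dissipation"
  proof -
    have "flux K \<bullet> (p (K + 1) - p K) = - (real N * (log_jump K \<bullet> (mobility K *v log_jump K)))"
      if K: "K \<in> {1..N-1} - {L}" for K
    proof -
      have "J K = real N *\<^sub>R ((1 / real N) *\<^sub>R J K)" using N_pos by simp
      also have "\<dots> = - (real N *\<^sub>R (mobility K *v log_jump K))"
        using K by (subst flux_mobility) auto
      finally have "flux K = - (real N *\<^sub>R (mobility K *v log_jump K))"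
        using K by (simp add: flux_def)
      moreover have "p (K + 1) - p K = log_jump K"
        using K by (auto simp: vec_eq_iff p_def D_edge_def vec_log_def phase_of_cell_def)
      ultimately show ?thesis by (simp add: inner_commute)
    qed
    then show ?thesis by (simp add: sum_negf sum_distrib_left[symmetric])
  qed
  finally show ?thesis by simp
qed

section \<open>Post-processing\<close>

lemma index_moves_at_most_one:
  "interface_index N Xt = L \<or> interface_index N Xt = L + 1 \<or> interface_index N Xt + 1 = L"
proof -
  let ?L' = "interface_index N Xt"
  \<comment> \<open>The three distances add up to less than two cells.  Naming the width keeps the goal linear.\<close>
  obtain dx where dx: "dx = 1 / real N" by simp
  have "2 * \<bar>edge_pos N ?L' - Xt\<bar> \<le> 1 / real N"
    using interface_index_close[of N Xt] L Xt by simp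
  with X0_close Xt_close dx_pos have "\<bar>edge_pos N ?L' - edge_pos N L\<bar> < 2 * (1 / real N)"
    unfolding dx[symmetric] by (smt (verit) field_sum_of_halves)
  then have "\<bar>real ?L' - real L\<bar> / real N < 2 / real N"
    by (simp add: edge_pos_def diff_divide_distrib[symmetric])
  then have "\<bar>real ?L' - real L\<bar> < 2"
    using N_pos by (simp add: divide_less_cancel)
  then show ?thesis by linarith
qed

text \<open>
  If the index moves by one, only three cells change.  The solid (or gas) side cell is cut in two at
  constant composition, which preserves its energy; the two cells of the other phase are merged
  into their weighted mean, and Jensen's inequality applies.
\<close>

lemma post_processing_energy_le:
  assumes post: "post_processing N X0 cs Xt c1 X1"
    and two_phases: "interface_index N Xt \<noteq> 1" "interface_index N Xt \<noteq> N"
  shows "free_energy mu N c1 X1 \<le> intermediate_energy"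
proof -
  let ?L' = "interface_index N Xt"
  have X1: "X1 = Xt" using post two_phases by (simp add: post_processing_def Let_def)
  let ?t1 = "\<lambda>K. moved_size N ?L' Xt K * energy_density mu (phase_of_cell N Xt K) (c1 K)"
  let ?t = "\<lambda>K. d K * energy_density mu (phase_of_cell N X0 K) (cs K)"
  have local_change: "(\<Sum>K=1..N. ?t1 K) \<le> (\<Sum>K=1..N. ?t K)"
    if "S \<subseteq> {1..N}" "\<And>K. K \<in> {1..N} - S \<Longrightarrow> ?t1 K = ?t K" "sum ?t1 S \<le> sum ?t S" for S
  proof -
    have "(\<Sum>K=1..N. ?t1 K) = sum ?t1 ({1..N} - S) + sum ?t1 S"
      "(\<Sum>K=1..N. ?t K) = sum ?t ({1..N} - S) + sum ?t S"
      using that(1) by (auto intro: sum.subset_diff)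
    moreover have "sum ?t1 ({1..N} - S) = sum ?t ({1..N} - S)"
      using that(2) by (rule sum.cong[OF refl])
    ultimately show ?thesis using that(3) by linarith
  qed
  consider "?L' = L" | "?L' = L + 1" | "?L' + 1 = L"
    using index_moves_at_most_one by blast
  then have "(\<Sum>K=1..N. ?t1 K) \<le> (\<Sum>K=1..N. ?t K)"
  proof cases
    case 1
    then show ?thesis
      using post by (intro sum_mono) (simp add: post_processing_def Let_def phase_of_cell_def)
  next
    case 2
    with two_phases interface_index_nearest[of N Xt] have N: "L + 1 < N" by auto
    let ?y = "(1 / (d (L + 1) + 1 / real N)) *\<^sub>R (d (L + 1) *\<^sub>R cs (L + 1) + (1 / real N) *\<^sub>R cs (L + 2))"
    have c1: "c1 K = (if K = L \<or> K = L + 1 then cs L else if K = L + 2 then ?y else cs K)"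
      if "K \<in> {1..N}" for K
      using post 2 N that by (simp add: post_processing_def Let_def add.commute)
    show ?thesis
    proof (rule local_change[of "{L, L + 1, L + 2}"])
      show "{L, L + 1, L + 2} \<subseteq> {1..N}" using L N by auto
      show "?t1 K = ?t K" if "K \<in> {1..N} - {L, L + 1, L + 2}" for K
        using that 2 c1[of K] by (auto simp: moved_size_def phase_of_cell_def)
      have jensen: "(d (L + 1) + 1 / real N) * energy_density mu Gas ?y
          \<le> d (L + 1) * energy_density mu Gas (cs (L + 1)) + 1 / real N * energy_density mu Gas (cs (L + 2))"
        using L N by (intro energy_density_jensen d_pos dx_pos cs_nonneg) auto
      have sizes: "moved_size N ?L' Xt L + moved_size N ?L' Xt (L + 1) = d L"
        "moved_size N ?L' Xt (L + 2) = d (L + 1) + 1 / real N" "d (L + 2) = 1 / real N"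
        using L by (simp_all add: 2 moved_size_def edge_pos_pred edge_pos_Suc)
      have "sum ?t1 {L, L + 1, L + 2}
          = (moved_size N ?L' Xt L + moved_size N ?L' Xt (L + 1)) * energy_density mu Solid (cs L)
            + moved_size N ?L' Xt (L + 2) * energy_density mu Gas ?y"
        using L N by (simp add: c1 2 phase_of_cell_def distrib_right)
      also have "\<dots> \<le> sum ?t {L, L + 1, L + 2}"
        unfolding sizes using jensen by (simp add: phase_of_cell_def sizes(3)[simplified])
      finally show "sum ?t1 {L, L + 1, L + 2} \<le> sum ?t {L, L + 1, L + 2}" .
    qed
  next
    case 3
    define M where "M = ?L'"
    have M: "L = M + 1" "1 < M" "?L' = M"
      using 3 two_phases(1) L by (auto simp: M_def)
    let ?y = "(1 / (1 / real N + d L)) *\<^sub>R ((1 / real N) *\<^sub>R cs M + d L *\<^sub>R cs L)"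
    have c1: "c1 K = (if K = L \<or> K = L + 1 then cs (L + 1) else if K = M then ?y else cs K)"
      if "K \<in> {1..N}" for K
      using post 3 M(2,3) that by (auto simp: post_processing_def Let_def M(1))
    show ?thesis
    proof (rule local_change[of "{M, L, L + 1}"])
      show "{M, L, L + 1} \<subseteq> {1..N}" using L M by auto
      show "?t1 K = ?t K" if "K \<in> {1..N} - {M, L, L + 1}" for K
        using that M c1[of K] by (auto simp: moved_size_def phase_of_cell_def)
      have jensen: "(1 / real N + d L) * energy_density mu Solid ?y
          \<le> 1 / real N * energy_density mu Solid (cs M) + d L * energy_density mu Solid (cs L)"
        using L M(1,2) by (intro energy_density_jensen d_pos dx_pos cs_nonneg) auto
      have sizes: "moved_size N ?L' Xt L + moved_size N ?L' Xt (L + 1) = d (L + 1)"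
        "moved_size N ?L' Xt M = 1 / real N + d L" "d M = 1 / real N"
        using M by (simp_all add: moved_size_def edge_pos_pred edge_pos_Suc)
      have "sum ?t1 {M, L, L + 1}
          = (moved_size N ?L' Xt L + moved_size N ?L' Xt (L + 1)) * energy_density mu Gas (cs (L + 1))
            + moved_size N ?L' Xt M * energy_density mu Solid ?y"
        using L M by (simp add: c1 phase_of_cell_def distrib_right)
      also have "\<dots> \<le> sum ?t {M, L, L + 1}"
        unfolding sizes using jensen sizes(3) M by (simp add: phase_of_cell_def)
      finally show "sum ?t1 {M, L, L + 1} \<le> sum ?t {M, L, L + 1}" .
    qed
  qed
  then show ?thesis
    by (simp add: free_energy_def intermediate_energy_def X1 cell_size_def)
qed

end

section \<open>Decay of the free energy\<close>

theorem lemma4: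
  fixes kappa :: "phase \<Rightarrow> 'n::finite \<Rightarrow> 'n \<Rightarrow> real"
    and mu :: "phase \<Rightarrow> real ^ 'n"
    and T :: "real ^ 'n \<Rightarrow> real ^ 'n"
    and N :: nat and dt :: real
    and c0 cs c1 J :: "nat \<Rightarrow> real ^ 'n"
    and X0 Xt X1 :: real
  defines "L \<equiv> interface_index N X0"
  assumes species: "2 \<le> CARD('n)"
    and kappa_sym: "\<And>\<alpha> i j. i \<noteq> j \<Longrightarrow> kappa \<alpha> i j = kappa \<alpha> j i"
    and kappa_pos: "\<And>\<alpha> i j. i \<noteq> j \<Longrightarrow> 0 < kappa \<alpha> i j"
    and T: "truncation_map T"
    and T_sum: "\<And>x. (\<Sum>i\<in>UNIV. x $ i) = 1 \<Longrightarrow> (\<Sum>i\<in>UNIV. T x $ i) \<le> 1"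
    and N: "1 \<le> N"
    and dt: "0 < dt" "dt < (1 / real N) / (2 * time_step_const mu)"
    and c0: "\<And>K. K \<in> {1..N} \<Longrightarrow> c0 K \<in> composition_simplex"
    and X0: "0 < X0" "X0 < 1"
    and L: "1 < L" "L < N"
    and scheme: "modified_scheme kappa mu T N dt c0 X0 cs Xt J"
    and post: "post_processing N X0 cs Xt c1 X1"
    and two_phases: "interface_index N Xt \<noteq> 1" "interface_index N Xt \<noteq> N"
  shows "free_energy mu N c1 X1
           + dt / (1 / real N) *
               (\<Sum>K\<in>{1..N - 1} - {L}.
                  D_edge (\<lambda>K. vec_log (cs K)) K \<bullet>
                    (M_hat kappa (phase_of_cell N X0 K) (edge_value cs K)
                       *v D_edge (\<lambda>K. vec_log (cs K)) K))
           + dt * (\<Sum>i\<in>UNIV. interface_rate mu (cs L) (cs (L + 1)) $ i *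
               ((ln (cs (L + 1) $ i) + mu Gas $ i) - (ln (cs L $ i) + mu Solid $ i)))
         \<le> free_energy mu N c0 X0
         \<and> free_energy mu N c1 X1 \<le> free_energy mu N c0 X0"
proof -
  interpret scheme_step kappa mu T N dt c0 cs J X0 Xt
    by unfold_locales
       (use species kappa_sym kappa_pos T T_sum dt c0 X0 L scheme in \<open>auto simp: L_def\<close>)
  show ?thesis
    unfolding L_def
    using intermediate_energy_le post_processing_energy_le[OF post two_phases]
      dissipation_nonneg exchange_nonneg
    by linarith
qed

end
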